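(* Let $\epsilon\in\{1,-1\}$ and let $Q(\lambda)=\lambda^2A_1^{\star}+\lambda A_0+\epsilon A_1$ be a regular $\star$-(anti)-palindromic system ($A_1,A_0\in\mathbb{C}^{n\times n}$, $A_0^{\star}=\epsilon A_0$, $A_1$ nonsingular). Let $(X_1,T_1)\in\mathbb{C}^{n\times k}\times\mathbb{C}^{k\times k}$ and $(X_2,T_2)\in\mathbb{C}^{n\times(2n-k)}\times\mathbb{C}^{(2n-k)\times(2n-k)}$ be such that $([X_1\ X_2],\mathrm{diag}(T_1,T_2))$ is a standard pair of $Q(\lambda)$ ($(X_1,T_1)$ carrying the $k$ eigenpairs to be replaced and $(X_2,T_2)$ the remaining $2n-k$ ones), and let $\widetilde T_1=\mathrm{diag}(\tilde\lambda_1,\dots,\tilde\lambda_k)$ contain the desired new eigenvalues. Assume that $T_1$ is similar to $T_1^{-\star}$ and that $T_1$ and $T_2$ have no common eigenvalue. Let $$S_1=(\epsilon X_1^{\star}A_1X_1T_1^{-1}-T_1^{-\star}X_1^{\star}A_1^{\star}X_1)^{-1}.$$ Suppose there exist a nonsingular $\widetilde S_1\in\mathbb{S}_{\widetilde T_1}$ and a solution $\widetilde X_1\in\mathbb{C}^{n\times k}$ to $$\widetilde X_1\widetilde S_1\widetilde X_1^{\star}=X_1S_1X_1^{\star}$$ such that $\Xi:=I_{\ell}+\epsilon Z_2^{\star}A_1Z_1$ is nonsingular, where $Z_1,Z_2\in\mathbb{C}^{n\times\ell}$ are determined by the rank factorization $$\widetilde X_1\widetilde T_1^{-1}\widetilde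 S_1\widetilde X_1^{\star}-X_1T_1^{-1}S_1X_1^{\star}=Z_1Z_2^{\star}.$$ Then a regular solution $\widetilde Q(\lambda)=\lambda^2\widetilde A_1^{\star}+\lambda\widetilde A_0+\epsilon\widetilde A_1$ to the MUP-QP is given by $$\widetilde A_1=A_1-\epsilon A_1Z_1\Xi^{-1}Z_2^{\star}A_1,$$ $$\widetilde A_0=(I-\epsilon A_1Z_1\Xi^{-1}Z_2^{\star})(A_0-A_1\Upsilon A_1)(I-\epsilon Z_1\Xi^{-1}Z_2^{\star}A_1),$$ where $\Upsilon=\widetilde X_1\widetilde T_1^{-2}\widetilde S_1\widetilde X_1^{\star}-X_1T_1^{-2}S_1X_1^{\star}$. That is, $\widetilde A_1$ is nonsingular, $\widetilde A_0^{\star}=\epsilon\widetilde A_0$, and $([\widetilde X_1\ X_2],\mathrm{diag}(\widetilde T_1,T_2))$ is a standard pair of $\widetilde Q(\lambda)$.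
   Context: The symbol $\star$ denotes one fixed operation, either the transpose $\top$ or the conjugate transpose $*$ (for complex matrices); $M^{-\star}=(M^{-1})^{\star}$. Standard pair: $(X,T)\in\mathbb{C}^{n\times 2n}\times\mathbb{C}^{2n\times 2n}$ (with $T$ nonsingular) is a standard pair of $Q(\lambda)=\lambda^2A_1^{\star}+\lambda A_0+\epsilon A_1$ if $\begin{bmatrix}X\\-XT^{-1}\end{bmatrix}$ is nonsingular and $A_1^{\star}XT^2+A_0XT+\epsilon A_1X=0$. $\mathbb{S}_{\widetilde T_1}=\{S\in\mathbb{C}^{k\times k}: S^{\star}=-\epsilon S,\ S=\widetilde T_1S\widetilde T_1^{\star}\}$. MUP-QP (model updating problem with no-spillover): given a regular $\star$-(anti)-palindromic system $Q(\lambda)$ and $k$ of its eigenpairs, update $Q$ to another regular $\star$-(anti)-palindromic system $\widetilde Q(\lambda)$ (same $\star$, $\epsilon$) such that the $k$ eigenvalues are replaced by $\tilde\lambda_1,\dots,\tilde\lambda_k$ while the remaining $2n-k$ eigenpairs are unchanged; in matrix form, find $\widetilde Q$ such that $([\widetilde X_1\ X_2],\mathrm{diag}(\widetilde T_1,T_2))$ is a standard pair of $\widetilde Q$, where the columns of $\widetilde X_1$ are the eigenvectors of $\widetilde Q$ for $\tilde\lambda_1,\dots,\tilde\lambda_k$. A rank factorization of a matrix $M\in\mathbb{C}^{n\times n}$ of rank $\ell$ is $M=Z_1Z_2^{\star}$ with $Z_1,Z_2\in\mathbb{C}^{n\times\ell}$ of full column rank. *)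

theory Defs
  imports
    "Jordan_Normal_Form.Schur_Decomposition"
    "Jordan_Normal_Form.Spectral_Radius"
    "Jordan_Normal_Form.DL_Rank"
begin

datatype star_op = Transpose | Conj_Transpose

fun mat_star :: "star_op \<Rightarrow> complex mat \<Rightarrow> complex mat" where
  "mat_star Transpose A = transpose_mat A"
| "mat_star Conj_Transpose A = mat_adjoint A"

text \<open>Only meaningful for nonsingular matrices; unspecified on singular ones.\<close>

definition mat_inv :: "complex mat \<Rightarrow> complex mat" where
  "mat_inv A = the (mat_inverse A)"

definition append_cols :: "complex mat \<Rightarrow> complex mat \<Rightarrow> complex mat" where
  "append_cols A B = four_block_mat A B (0\<^sub>m 0 (dim_col A)) (0\<^sub>m 0 (dim_col B))"

text \<open>The quadratic matrix polynomial
  \<open>Q(\<lambda>) = \<lambda>\<^sup>2 A1\<^sup>\<star> + \<lambda> A0 + \<epsilon> A1\<close>, evaluated at \<open>\<lambda> = z\<close>.\<close>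

definition pal_poly :: "star_op \<Rightarrow> complex \<Rightarrow> complex mat \<Rightarrow> complex mat \<Rightarrow> complex \<Rightarrow> complex mat" where
  "pal_poly s \<epsilon> A1 A0 z = z\<^sup>2 \<cdot>\<^sub>m mat_star s A1 + z \<cdot>\<^sub>m A0 + \<epsilon> \<cdot>\<^sub>m A1"

text \<open>Palindromic for \<open>\<epsilon> = 1\<close>, anti-palindromic for \<open>\<epsilon> = -1\<close>. Besides regularity
  (\<open>det Q\<close> is not identically zero) the coefficient \<open>A1\<close> is required to be nonsingular.\<close>

definition regular_pal_system :: "star_op \<Rightarrow> complex \<Rightarrow> nat \<Rightarrow> complex mat \<Rightarrow> complex mat \<Rightarrow> bool" where
  "regular_pal_system s \<epsilon> n A1 A0 \<longleftrightarrow>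
     A1 \<in> carrier_mat n n \<and> A0 \<in> carrier_mat n n \<and>
     mat_star s A0 = \<epsilon> \<cdot>\<^sub>m A0 \<and>
     invertible_mat A1 \<and>
     (\<exists>z. det (pal_poly s \<epsilon> A1 A0 z) \<noteq> 0)"

definition standard_pair ::
  "star_op \<Rightarrow> complex \<Rightarrow> nat \<Rightarrow> complex mat \<Rightarrow> complex mat \<Rightarrow> complex mat \<Rightarrow> complex mat \<Rightarrow> bool" where
  "standard_pair s \<epsilon> n A1 A0 X T \<longleftrightarrow>
     X \<in> carrier_mat n (2 * n) \<and> T \<in> carrier_mat (2 * n) (2 * n) \<and>
     invertible_mat T \<and>
     invertible_mat (X @\<^sub>r (- (X * mat_inv T))) \<and>
     mat_star s A1 * X * (T ^\<^sub>m 2) + A0 * X * T + \<epsilon> \<cdot>\<^sub>m (A1 * X) = 0\<^sub>m n (2 * n)"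

definition is_eigenpair ::
  "star_op \<Rightarrow> complex \<Rightarrow> nat \<Rightarrow> complex mat \<Rightarrow> complex mat \<Rightarrow> complex \<Rightarrow> complex vec \<Rightarrow> bool" where
  "is_eigenpair s \<epsilon> n A1 A0 z x \<longleftrightarrow>
     x \<in> carrier_vec n \<and> x \<noteq> 0\<^sub>v n \<and> pal_poly s \<epsilon> A1 A0 z *\<^sub>v x = 0\<^sub>v n"

definition S_set :: "star_op \<Rightarrow> complex \<Rightarrow> nat \<Rightarrow> complex mat \<Rightarrow> complex mat set" where
  "S_set s \<epsilon> k T =
     {S \<in> carrier_mat k k. mat_star s S = (- \<epsilon>) \<cdot>\<^sub>m S \<and> S = T * S * mat_star s T}"

definition rank_factorization ::
  "star_op \<Rightarrow> nat \<Rightarrow> nat \<Rightarrow> complex mat \<Rightarrow> complex mat \<Rightarrow> complex mat \<Rightarrow> bool" where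
  "rank_factorization s n l M Z1 Z2 \<longleftrightarrow>
     M \<in> carrier_mat n n \<and> vec_space.rank n M = l \<and>
     Z1 \<in> carrier_mat n l \<and> vec_space.rank n Z1 = l \<and>
     Z2 \<in> carrier_mat n l \<and> vec_space.rank n Z2 = l \<and>
     M = Z1 * mat_star s Z2"

text \<open>The updated system \<open>(A1', A0')\<close> carries the new eigenvalues \<open>mu 0, \<dots>, mu (k - 1)\<close> with
  the columns of \<open>X1'\<close> as eigenvectors, and keeps the part \<open>(X2, T2)\<close> of the original
  standard pair.\<close>

definition solves_MUP_QP ::
  "star_op \<Rightarrow> complex \<Rightarrow> nat \<Rightarrow> nat \<Rightarrow> complex mat \<Rightarrow> complex mat \<Rightarrow> (nat \<Rightarrow> complex) \<Rightarrow> complex mat \<Rightarrow>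
   complex mat \<Rightarrow> complex mat \<Rightarrow> bool" where
  "solves_MUP_QP s \<epsilon> n k X2 T2 mu X1' A1' A0' \<longleftrightarrow>
     regular_pal_system s \<epsilon> n A1' A0' \<and>
     standard_pair s \<epsilon> n A1' A0' (append_cols X1' X2) (diag_block_mat [mat_diag k mu, T2]) \<and>
     (\<forall>j<k. is_eigenpair s \<epsilon> n A1' A0' (mu j) (col X1' j))"

end

theory Submission
  imports Defs
begin

text \<open>
  Write \<open>U\<close> for the stacked matrix \<open>[X; - X T\<inverse>]\<close> of a pair \<open>(X, T)\<close>. Everything rests on the matrix
  \<open>W = \<epsilon> X\<^sup>\<star> A1 X T\<inverse> - T\<^sup>-\<^sup>\<star> X\<^sup>\<star> A1\<^sup>\<star> X\<close> (called \<open>pairing\<close> below), which factors as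
  \<open>W = U\<^sup>\<star> J U\<close> with \<open>J = [0, - \<epsilon> A1; A1\<^sup>\<star>, 0]\<close>. For a standard pair, \<open>U\<close> is nonsingular,
  hence so is \<open>W\<close>, and \<open>S = W\<inverse>\<close> satisfies \<open>U S U\<^sup>\<star> = J\<inverse>\<close>. Read block by block, this says
  \<open>X S X\<^sup>\<star> = 0\<close> and \<open>X T\<inverse> S X\<^sup>\<star> = \<epsilon> A1\<inverse>\<close>. The quadratic equation of the pair reads
  \<open>A1\<^sup>\<star> X T + A0 X + \<epsilon> A1 X T\<inverse> = 0\<close>. Multiplying it by \<open>X\<^sup>\<star>\<close> on the left and eliminating
  \<open>X\<^sup>\<star> A0 X\<close> between the result and its star gives \<open>T\<^sup>\<star> W T = W\<close>, that is \<open>S = T S T\<^sup>\<star>\<close>.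
  Multiplying it by \<open>T\<inverse> S X\<^sup>\<star>\<close> on the right gives \<open>A0 = - A1 (X T\<^sup>-\<^sup>2 S X\<^sup>\<star>) A1\<close>. So the
  coefficients of the system can be read off from \<open>(X, T, S)\<close>.

  Conversely (\<open>system_of_spectral_triple\<close>), whenever \<open>(X, T, S)\<close> has these symmetries, that
  formula for \<open>A0\<close> defines a regular system with the same \<open>\<star>\<close> and \<open>\<epsilon>\<close> that has \<open>(X, T)\<close> as a
  standard pair. Updating a system therefore amounts to updating a triple.

  For \<open>X = [X1 X2]\<close> and \<open>T = diag(T1, T2)\<close> the off-diagonal block \<open>W12\<close> of \<open>W\<close> solves the
  homogeneous Sylvester equation \<open>T1\<^sup>-\<^sup>\<star> W12 = W12 T2\<close>. Since \<open>T1\<^sup>-\<^sup>\<star>\<close> is similar to \<open>T1\<close>, it shares no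
  eigenvalue with \<open>T2\<close>; so \<open>W12 = 0\<close> and \<open>S = diag(S1, S2)\<close>, where \<open>S1\<close> is the matrix of the
  theorem. The symmetries of \<open>S\<close> then hold block by block, the expressions built from \<open>X\<close> are sums of
  a part with index 1 and a part with index 2, and only the first part is replaced. The hypothesis on \<open>X1' S1' X1'\<^sup>\<star>\<close> says
  that \<open>X S X\<^sup>\<star>\<close> does not change; \<open>X T\<inverse> S X\<^sup>\<star>\<close> changes by \<open>Z1 Z2\<^sup>\<star>\<close>, so that by
  the Sherman-Morrison-Woodbury formula its inverse becomes \<open>\<epsilon> A1'\<close>; and
  \<open>X T\<^sup>-\<^sup>2 S X\<^sup>\<star>\<close> changes by \<open>\<Upsilon>\<close>, which turns the formula for \<open>A0\<close> into the one for \<open>A0'\<close>.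
  Finally an eigenvector of \<open>T\<close> is mapped by \<open>X\<close> to an eigenvector of the quadratic
  polynomial, which makes the columns of \<open>X1'\<close> eigenvectors of the new system.
\<close>

section \<open>Matrix arithmetic from dimension equations\<close>

text \<open>
  The ring laws are restated with equations between dimensions in place of carrier membership, so
  that the simplifier can discharge the side conditions for arbitrary products of rectangular
  matrices without guessing inner dimensions.
\<close>

lemma mat_assoc: "dim_col A = dim_row B \<Longrightarrow> dim_col B = dim_row C \<Longrightarrow>
  (A :: 'a :: semiring_0 mat) * B * C = A * (B * C)"
  by (rule assoc_mult_mat) auto

lemma mat_add_mult: "dim_row A = dim_row B \<Longrightarrow> dim_col A = dim_col B \<Longrightarrow> dim_col A = dim_row C \<Longrightarrow>
  ((A :: 'a :: semiring_0 mat) + B) * C = A * C + B * C"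
  by (rule add_mult_distrib_mat) auto

lemma mat_mult_add: "dim_row B = dim_row C \<Longrightarrow> dim_col B = dim_col C \<Longrightarrow> dim_col A = dim_row B \<Longrightarrow>
  (A :: 'a :: semiring_0 mat) * (B + C) = A * B + A * C"
  by (rule mult_add_distrib_mat) auto

lemma mat_minus_mult: "dim_row A = dim_row B \<Longrightarrow> dim_col A = dim_col B \<Longrightarrow> dim_col A = dim_row C \<Longrightarrow>
  ((A :: 'a :: ring mat) - B) * C = A * C - B * C"
  by (rule minus_mult_distrib_mat) auto

lemma mat_mult_minus: "dim_row B = dim_row C \<Longrightarrow> dim_col B = dim_col C \<Longrightarrow> dim_col A = dim_row B \<Longrightarrow>
  (A :: 'a :: ring mat) * (B - C) = A * B - A * C"
  by (rule mult_minus_distrib_mat) auto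

lemma mat_smult_mult: "dim_col A = dim_row B \<Longrightarrow> (a \<cdot>\<^sub>m (A :: 'a :: comm_semiring_0 mat)) * B = a \<cdot>\<^sub>m (A * B)"
  by (rule mult_smult_assoc_mat) auto

lemma mat_mult_smult: "dim_col A = dim_row B \<Longrightarrow> (A :: 'a :: comm_semiring_0 mat) * (a \<cdot>\<^sub>m B) = a \<cdot>\<^sub>m (A * B)"
  by (rule mult_smult_distrib) auto

lemma mat_uminus_mult: "dim_col A = dim_row B \<Longrightarrow> (- (A :: 'a :: comm_ring_1 mat)) * B = - (A * B)"
  by (rule uminus_mult_left_mat) auto

lemma mat_mult_uminus: "dim_col A = dim_row B \<Longrightarrow> (A :: 'a :: comm_ring_1 mat) * (- B) = - (A * B)"
  by (rule uminus_mult_right_mat) auto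

lemma mat_smult_smult: "a \<cdot>\<^sub>m (b \<cdot>\<^sub>m (A :: 'a :: semiring_0 mat)) = (a * b) \<cdot>\<^sub>m A"
  by (rule eq_matI) (auto simp: mult.assoc)

lemma mat_smult_add: "dim_row A = dim_row B \<Longrightarrow> dim_col A = dim_col B \<Longrightarrow>
  a \<cdot>\<^sub>m ((A :: 'a :: semiring_0 mat) + B) = a \<cdot>\<^sub>m A + a \<cdot>\<^sub>m B"
  by (rule eq_matI) (auto simp: algebra_simps)

lemma mat_uminus_smult: "- (A :: 'a :: comm_ring_1 mat) = (-1) \<cdot>\<^sub>m A"
  by (rule eq_matI) auto

lemma mat_one_smult: "1 \<cdot>\<^sub>m (A :: 'a :: semiring_1 mat) = A"
  by (rule eq_matI) auto

lemmas mat_ring = mat_assoc mat_add_mult mat_mult_add mat_minus_mult mat_mult_minus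
  mat_smult_mult mat_mult_smult mat_uminus_mult mat_mult_uminus mat_smult_smult mat_smult_add

text \<open>
  Products are normalized to right-nested form by \<open>mat_ring\<close>; there a pair of inverse factors
  is adjacent only in this shape.
\<close>

lemma mat_cancel_left:
  "A * B = 1\<^sub>m n \<Longrightarrow> dim_col A = dim_row B \<Longrightarrow> dim_col B = dim_row C \<Longrightarrow> dim_row C = n
    \<Longrightarrow> A * (B * C) = (C :: 'a :: semiring_1 mat)"
  by (simp flip: mat_assoc)

lemma pow_mat_two: "A \<in> carrier_mat n n \<Longrightarrow> A ^\<^sub>m 2 = A * (A :: 'a :: semiring_1 mat)"
  by (simp add: numeral_2_eq_2)

lemma mat_add_eq_zero:
  assumes "A \<in> carrier_mat n m" "B \<in> carrier_mat n m" and sum: "A + B = 0\<^sub>m n m"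
  shows "A = - (B :: 'a :: ab_group_add mat)"
proof (rule eq_matI)
  fix i j assume "i < dim_row (- B)" "j < dim_col (- B)"
  then show "A $$ (i, j) = (- B) $$ (i, j)"
    using arg_cong[OF sum, of "\<lambda>M. M $$ (i, j)"] assms(1,2) by (simp add: add_eq_0_iff2)
qed (use assms in auto)

lemma smult_mat_mult_vec: "dim_col A = dim_vec v \<Longrightarrow> (a \<cdot>\<^sub>m A) *\<^sub>v v = a \<cdot>\<^sub>v ((A :: 'a :: comm_ring_1 mat) *\<^sub>v v)"
  by (rule eq_vecI) auto

section \<open>The operation \<open>\<star>\<close> on matrices\<close>

text \<open>
  The effect of \<open>\<star>\<close> on entries: \<open>mat_star s\<close> is transposition followed by this involution of
  the field, which treats both readings of \<open>\<star>\<close> at once.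
\<close>

fun scalar_star :: "star_op \<Rightarrow> complex \<Rightarrow> complex" where
  "scalar_star Transpose z = z"
| "scalar_star Conj_Transpose z = cnj z"

lemma scalar_star_simps [simp]:
  "scalar_star s (x + y) = scalar_star s x + scalar_star s y"
  "scalar_star s (x - y) = scalar_star s x - scalar_star s y"
  "scalar_star s (- x) = - scalar_star s x"
  "scalar_star s (x * y) = scalar_star s x * scalar_star s y"
  "scalar_star s 0 = 0" "scalar_star s 1 = 1"
  "scalar_star s (scalar_star s x) = x"
  by (cases s; simp)+

lemma scalar_star_sum: "scalar_star s (sum f I) = (\<Sum>i\<in>I. scalar_star s (f i))"
  by (cases s) auto

text \<open>
  As \<open>\<epsilon>\<close> is a real sign, it may be moved through \<open>\<star>\<close> under both readings.
\<close>

lemma scalar_star_eps [simp]: "\<epsilon> \<in> {1, -1} \<Longrightarrow> scalar_star s \<epsilon> = \<epsilon>"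
  by (cases s) auto

lemma eps_square: "\<epsilon> \<in> {1, -1} \<Longrightarrow> \<epsilon> * \<epsilon> = (1 :: complex)"
  by auto

lemma dim_mat_star [simp]:
  "dim_row (mat_star s A) = dim_col A" "dim_col (mat_star s A) = dim_row A"
  by (cases s; simp add: mat_adjoint_def)+

lemma index_mat_star [simp]:
  "i < dim_col A \<Longrightarrow> j < dim_row A \<Longrightarrow> mat_star s A $$ (i, j) = scalar_star s (A $$ (j, i))"
  by (cases s) (auto simp: mat_adjoint_def mat_of_rows_def)

lemma mat_star_carrier [simp]: "A \<in> carrier_mat n m \<Longrightarrow> mat_star s A \<in> carrier_mat m n"
  by auto

lemma mat_star_star [simp]: "mat_star s (mat_star s A) = A"
  by (rule eq_matI) auto

lemma mat_star_mult: "dim_col A = dim_row B \<Longrightarrow> mat_star s (A * B) = mat_star s B * mat_star s A"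
  by (rule eq_matI) (auto simp: scalar_prod_def scalar_star_sum mult.commute)

lemma mat_star_add: "dim_row A = dim_row B \<Longrightarrow> dim_col A = dim_col B \<Longrightarrow>
   mat_star s (A + B) = mat_star s A + mat_star s B"
  by (rule eq_matI) auto

lemma mat_star_minus: "dim_row A = dim_row B \<Longrightarrow> dim_col A = dim_col B \<Longrightarrow>
   mat_star s (A - B) = mat_star s A - mat_star s B"
  by (rule eq_matI) auto

lemma mat_star_uminus: "mat_star s (- A) = - mat_star s A"
  by (rule eq_matI) auto

lemma mat_star_smult: "mat_star s (a \<cdot>\<^sub>m A) = scalar_star s a \<cdot>\<^sub>m mat_star s A"
  by (rule eq_matI) auto

lemma mat_star_one [simp]: "mat_star s (1\<^sub>m n) = 1\<^sub>m n"
  by (rule eq_matI) auto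

lemma mat_star_zero [simp]: "mat_star s (0\<^sub>m n m) = 0\<^sub>m m n"
  by (rule eq_matI) auto

lemmas mat_star_simps = mat_star_mult mat_star_add mat_star_minus mat_star_uminus mat_star_smult

section \<open>Inverses\<close>

lemma mat_inv_props:
  assumes A: "A \<in> carrier_mat n n" and inv: "invertible_mat A"
  shows "mat_inv A \<in> carrier_mat n n" "A * mat_inv A = 1\<^sub>m n" "mat_inv A * A = 1\<^sub>m n"
proof -
  obtain B where B: "inverts_mat A B" "inverts_mat B A"
    using inv unfolding invertible_mat_def by blast
  have AB: "A * B = 1\<^sub>m n" "B * A = 1\<^sub>m (dim_row B)" using B A unfolding inverts_mat_def by auto
  have "dim_row B = n"  using arg_cong[OF AB(2), of dim_col] A by auto
  moreover have "dim_col B = n" using arg_cong[OF AB(1), of dim_col] by auto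
  ultimately have Bc: "B \<in> carrier_mat n n" by auto
  have "A \<in> Units (ring_mat TYPE(complex) n ())"
    using A Bc AB unfolding Units_def by (auto simp: ring_mat_def)
  then obtain C where "mat_inverse A = Some C"
    using mat_inverse(1)[OF A] by fastforce
  with mat_inverse(2)[OF A this] show "mat_inv A \<in> carrier_mat n n" "A * mat_inv A = 1\<^sub>m n"
     "mat_inv A * A = 1\<^sub>m n" unfolding mat_inv_def by auto
qed

lemma invertible_matI:
  assumes "A \<in> carrier_mat n n" "B \<in> carrier_mat n n" "A * B = 1\<^sub>m n"
  shows "invertible_mat (A :: 'a :: field mat)"
  using assms mat_mult_left_right_inverse[OF assms]
  unfolding invertible_mat_def inverts_mat_def by auto

lemma mat_inv_eqI:
  assumes A: "A \<in> carrier_mat n n" and B: "B \<in> carrier_mat n n" and AB: "A * B = 1\<^sub>m n"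
  shows "mat_inv A = B"
proof -
  note I = mat_inv_props[OF A invertible_matI[OF A B AB]]
  have "mat_inv A = mat_inv A * (A * B)" using AB I by simp
  also have "\<dots> = B" using I A B by (simp flip: mat_assoc)
  finally show ?thesis .
qed

lemma invertible_mat_iff_det:
  assumes A: "A \<in> carrier_mat n n"
  shows "invertible_mat (A :: complex mat) \<longleftrightarrow> det A \<noteq> 0"
proof
  assume "invertible_mat A"
  note I = mat_inv_props[OF A this]
  have "det A * det (mat_inv A) = 1" using det_mult[OF A I(1)] I(2) by simp
  then show "det A \<noteq> 0" by auto
next
  assume "det A \<noteq> 0"
  from det_non_zero_imp_unit[OF A this, of "()"]
  obtain B where "B \<in> carrier_mat n n" "A * B = 1\<^sub>m n" unfolding Units_def by (auto simp: ring_mat_def)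
  then show "invertible_mat A" using invertible_matI[OF A] by blast
qed

lemma mult_invertible_right_cancel:
  assumes "invertible_mat U" "U \<in> carrier_mat m m" "A \<in> carrier_mat n m" "B \<in> carrier_mat n m"
    and "A * U = B * (U :: complex mat)"
  shows "A = B"
proof -
  note I = mat_inv_props[OF assms(2,1)]
  have "A * U * mat_inv U = B * U * mat_inv U" using assms by simp
  then show ?thesis using I assms(2-4) by (simp add: mat_assoc)
qed

lemma invertible_mat_star:
  assumes A: "A \<in> carrier_mat n n" "invertible_mat A"
  shows "invertible_mat (mat_star s A)" "mat_inv (mat_star s A) = mat_star s (mat_inv A)"
proof -
  note I = mat_inv_props[OF A]
  have *: "mat_star s A * mat_star s (mat_inv A) = 1\<^sub>m n"
    using I A by (simp flip: mat_star_mult)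
  show "invertible_mat (mat_star s A)" "mat_inv (mat_star s A) = mat_star s (mat_inv A)"
    using invertible_matI[OF _ _ *] mat_inv_eqI[OF _ _ *] A(1) I(1) by simp_all
qed

section \<open>Block matrices\<close>

lemma four_block_mat_inject:
  assumes "four_block_mat A B C D = four_block_mat A' B' C' D'"
    and "A \<in> carrier_mat a c" "B \<in> carrier_mat a d" "C \<in> carrier_mat b c" "D \<in> carrier_mat b d"
    and "A' \<in> carrier_mat a c" "B' \<in> carrier_mat a d" "C' \<in> carrier_mat b c" "D' \<in> carrier_mat b d"
  shows "A = A'" "B = B'" "C = C'" "D = D'"
proof -
  have eq: "four_block_mat A B C D $$ (i, j) = four_block_mat A' B' C' D' $$ (i, j)" for i j
    using assms(1) by simp
  show "A = A'"
  proof (rule eq_matI)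
    fix i j assume "i < dim_row A'" "j < dim_col A'"
    then show "A $$ (i, j) = A' $$ (i, j)" using eq[of i j] assms(2-) by simp
  qed (use assms in auto)
  show "B = B'"
  proof (rule eq_matI)
    fix i j assume "i < dim_row B'" "j < dim_col B'"
    then show "B $$ (i, j) = B' $$ (i, j)" using eq[of i "c + j"] assms(2-) by simp
  qed (use assms in auto)
  show "C = C'"
  proof (rule eq_matI)
    fix i j assume "i < dim_row C'" "j < dim_col C'"
    then show "C $$ (i, j) = C' $$ (i, j)" using eq[of "a + i" j] assms(2-) by simp
  qed (use assms in auto)
  show "D = D'"
  proof (rule eq_matI)
    fix i j assume "i < dim_row D'" "j < dim_col D'"
    then show "D $$ (i, j) = D' $$ (i, j)" using eq[of "a + i" "c + j"] assms(2-) by simp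
  qed (use assms in auto)
qed

lemma dim_append_cols [simp]:
  "dim_row (append_cols A B) = dim_row A" "dim_col (append_cols A B) = dim_col A + dim_col B"
  unfolding append_cols_def by simp_all

lemma dim_append_rows [simp]:
  "dim_row (A @\<^sub>r B) = dim_row A + dim_row B" "dim_col (A @\<^sub>r B) = dim_col A"
  unfolding append_rows_def by simp_all

lemma index_append_cols [simp]:
  "i < dim_row A \<Longrightarrow> j < dim_col A + dim_col B \<Longrightarrow>
   append_cols A B $$ (i, j) = (if j < dim_col A then A $$ (i, j) else B $$ (i, j - dim_col A))"
  unfolding append_cols_def by auto

lemma index_append_rows [simp]:
  "i < dim_row A + dim_row B \<Longrightarrow> j < dim_col A \<Longrightarrow>
   (A @\<^sub>r B) $$ (i, j) = (if i < dim_row A then A $$ (i, j) else B $$ (i - dim_row A, j))"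
  unfolding append_rows_def by auto

lemma mat_star_append_cols:
  "dim_row A = dim_row B \<Longrightarrow> mat_star s (append_cols A B) = mat_star s A @\<^sub>r mat_star s B"
  by (rule eq_matI) auto

lemma mat_star_append_rows:
  "dim_col A = dim_col B \<Longrightarrow> mat_star s (A @\<^sub>r B) = append_cols (mat_star s A) (mat_star s B)"
  by (rule eq_matI) auto

lemma mat_star_four_block:
  assumes "A \<in> carrier_mat a c" "B \<in> carrier_mat a d" "C \<in> carrier_mat b c" "D \<in> carrier_mat b d"
  shows "mat_star s (four_block_mat A B C D)
    = four_block_mat (mat_star s A) (mat_star s C) (mat_star s B) (mat_star s D)"
  by (rule eq_matI) (use assms in auto)

lemma append_cols_mult_append_rows:
  assumes "A \<in> carrier_mat n a" "B \<in> carrier_mat n b" "C \<in> carrier_mat a m" "D \<in> carrier_mat b m"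
  shows "append_cols A B * (C @\<^sub>r D) = A * C + B * (D :: complex mat)"
  using assms unfolding append_cols_def append_rows_def
  by (subst mult_four_block_mat[of _ n a _ b _ 0 _ _ m _ 0]) auto

lemma append_rows_mult:
  assumes "A \<in> carrier_mat a n" "B \<in> carrier_mat b n" "C \<in> carrier_mat n m"
  shows "(A @\<^sub>r B) * C = (A * C) @\<^sub>r (B * (C :: 'a :: semiring_0 mat))"
  by (rule eq_matI) (use assms in \<open>auto simp: row_def scalar_prod_def intro!: sum.cong\<close>)

lemma mult_append_cols:
  assumes "A \<in> carrier_mat n a" "B \<in> carrier_mat a b" "C \<in> carrier_mat a c"
  shows "A * append_cols B C = append_cols (A * B) (A * (C :: complex mat))"
  by (rule eq_matI) (use assms in \<open>auto simp: col_def scalar_prod_def intro!: sum.cong\<close>)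

lemma append_rows_append_cols:
  assumes "A \<in> carrier_mat a c" "B \<in> carrier_mat a d" "C \<in> carrier_mat b c" "D \<in> carrier_mat b d"
  shows "append_cols A B @\<^sub>r append_cols C D = four_block_mat A B C D"
  by (rule eq_matI) (use assms in auto)

lemma append_cols_mult_four_block:
  assumes "A \<in> carrier_mat n a" "B \<in> carrier_mat n b"
    "P \<in> carrier_mat a c" "Q \<in> carrier_mat a d" "R \<in> carrier_mat b c" "S \<in> carrier_mat b d"
  shows "append_cols A B * four_block_mat P Q R S
    = append_cols (A * P + B * R) (A * Q + B * (S :: complex mat))"
proof -
  have "append_cols A B * four_block_mat P Q R S = append_cols A B * (append_cols P Q @\<^sub>r append_cols R S)"
    by (subst append_rows_append_cols) (use assms in auto)
  also have "\<dots> = A * append_cols P Q + B * append_cols R S"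
    by (rule append_cols_mult_append_rows) (use assms in auto)
  also have "\<dots> = append_cols (A * P + B * R) (A * Q + B * S)"
    using assms mult_append_cols[of A n a P c Q d] mult_append_cols[of B n b R c S d]
    by (auto intro!: eq_matI)
  finally show ?thesis .
qed

lemma append_rows_mult_append_cols:
  assumes "A \<in> carrier_mat a n" "B \<in> carrier_mat b n" "C \<in> carrier_mat n c" "D \<in> carrier_mat n d"
  shows "(A @\<^sub>r B) * append_cols C D = four_block_mat (A * C) (A * D) (B * C) (B * (D :: complex mat))"
proof -
  have "(A @\<^sub>r B) * append_cols C D = (A * append_cols C D) @\<^sub>r (B * append_cols C D)"
    by (rule append_rows_mult) (use assms in auto)
  also have "\<dots> = append_cols (A * C) (A * D) @\<^sub>r append_cols (B * C) (B * D)"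
    using mult_append_cols[OF assms(1,3,4)] mult_append_cols[OF assms(2,3,4)] by simp
  also have "\<dots> = four_block_mat (A * C) (A * D) (B * C) (B * D)"
    by (rule append_rows_append_cols) (use assms in auto)
  finally show ?thesis .
qed

lemma append_cols_mult_star:
  assumes "X1 \<in> carrier_mat n a" "X2 \<in> carrier_mat n b" "Y1 \<in> carrier_mat n a" "Y2 \<in> carrier_mat n b"
  shows "append_cols X1 X2 * mat_star s (append_cols Y1 Y2) = X1 * mat_star s Y1 + X2 * mat_star s Y2"
  using assms by (subst mat_star_append_cols) (auto intro!: append_cols_mult_append_rows)

lemma smult_minus_four_block:
  assumes "A \<in> carrier_mat a c" "B \<in> carrier_mat a d" "C \<in> carrier_mat b c" "D \<in> carrier_mat b d"
    and "A' \<in> carrier_mat a c" "B' \<in> carrier_mat a d" "C' \<in> carrier_mat b c" "D' \<in> carrier_mat b d"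
  shows "\<epsilon> \<cdot>\<^sub>m four_block_mat A B C D - four_block_mat A' B' C' D'
    = four_block_mat (\<epsilon> \<cdot>\<^sub>m A - A') (\<epsilon> \<cdot>\<^sub>m B - B') (\<epsilon> \<cdot>\<^sub>m C - C') (\<epsilon> \<cdot>\<^sub>m D - (D' :: 'a :: comm_ring_1 mat))"
  by (rule eq_matI) (use assms in auto)

text \<open>
  Used with \<open>J = [0, - \<epsilon> A1; A1\<^sup>\<star>, 0]\<close> and its inverse.
\<close>

lemma antidiagonal_block_mult:
  assumes "P \<in> carrier_mat n n" "Q \<in> carrier_mat n n" "P' \<in> carrier_mat n n" "Q' \<in> carrier_mat n n"
    and "P * Q' = 1\<^sub>m n" "Q * P' = 1\<^sub>m n"
  shows "four_block_mat (0\<^sub>m n n) P Q (0\<^sub>m n n) * four_block_mat (0\<^sub>m n n) P' Q' (0\<^sub>m n n)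
    = (1\<^sub>m (n + n) :: 'a :: comm_ring_1 mat)"
  using assms by (subst mult_four_block_mat[of _ n n _ n _ n _ _ n _ n]) auto

text \<open>
  With \<open>Y = - X T\<inverse>\<close> this displays the blocks of \<open>U S U\<^sup>\<star>\<close>, the identities on which both
  directions between standard pairs and triples are based.
\<close>

lemma stacked_gram:
  assumes X: "X \<in> carrier_mat n m" and Y: "Y \<in> carrier_mat n m" and S: "S \<in> carrier_mat m m"
  shows "(X @\<^sub>r Y) * S * mat_star s (X @\<^sub>r Y) =
    four_block_mat (X * S * mat_star s X) (X * S * mat_star s Y) (Y * S * mat_star s X) (Y * S * mat_star s Y)"
proof -
  have "(X @\<^sub>r Y) * S * mat_star s (X @\<^sub>r Y)
    = (X * S @\<^sub>r Y * S) * append_cols (mat_star s X) (mat_star s Y)"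
    using assms append_rows_mult[OF assms] by (subst mat_star_append_rows) auto
  also have "\<dots> = X * S * append_cols (mat_star s X) (mat_star s Y) @\<^sub>r
       Y * S * append_cols (mat_star s X) (mat_star s Y)"
    by (rule append_rows_mult) (use assms in auto)
  also have "\<dots> = append_cols (X * S * mat_star s X) (X * S * mat_star s Y) @\<^sub>r
       append_cols (Y * S * mat_star s X) (Y * S * mat_star s Y)"
    using assms by (subst (1 2) mult_append_cols) auto
  also have "\<dots> = four_block_mat (X * S * mat_star s X) (X * S * mat_star s Y)
       (Y * S * mat_star s X) (Y * S * mat_star s Y)"
    by (rule append_rows_append_cols) (use assms in auto)
  finally show ?thesis .
qed

lemma diag_block_mat_pair:
  "diag_block_mat [A, B] = four_block_mat A (0\<^sub>m (dim_row A) (dim_col B)) (0\<^sub>m (dim_row B) (dim_col A)) B"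
  by (simp only: diag_block_mat.simps(2)[of A] diag_block_mat_singleton Let_def)

text \<open>
  Block-diagonal matrices with two blocks are treated as units by the laws below; unfolding the
  list recursion would leave a spurious empty third block.
\<close>

declare diag_block_mat.simps(2) [simp del]

lemma diag_pair_carrier:
  "A \<in> carrier_mat a a \<Longrightarrow> B \<in> carrier_mat b b \<Longrightarrow> diag_block_mat [A, B] \<in> carrier_mat (a + b) (a + b)"
  unfolding diag_block_mat_pair by auto

lemma diag_pair_mult:
  assumes "A \<in> carrier_mat a a" "B \<in> carrier_mat b b" "C \<in> carrier_mat a a" "D \<in> carrier_mat b b"
  shows "diag_block_mat [A, B] * diag_block_mat [C, D] = diag_block_mat [A * C, B * (D :: 'a :: comm_ring_1 mat)]"
  unfolding diag_block_mat_pair using assms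
  by (subst mult_four_block_mat[of _ a a _ b _ b _ _ a _ b]) auto

lemma mat_star_diag_pair:
  assumes "A \<in> carrier_mat a a" "B \<in> carrier_mat b b"
  shows "mat_star s (diag_block_mat [A, B]) = diag_block_mat [mat_star s A, mat_star s B]"
  unfolding diag_block_mat_pair using assms by (subst mat_star_four_block[of _ a a _ b _ b]) auto

lemma smult_diag_pair:
  assumes "A \<in> carrier_mat a a" "B \<in> carrier_mat b b"
  shows "c \<cdot>\<^sub>m diag_block_mat [A, B] = diag_block_mat [c \<cdot>\<^sub>m A, c \<cdot>\<^sub>m (B :: 'a :: comm_ring_1 mat)]"
  unfolding diag_block_mat_pair by (rule eq_matI) (use assms in auto)

lemma diag_pair_inject:
  assumes "diag_block_mat [A, B] = diag_block_mat [C, D]"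
    and "A \<in> carrier_mat a a" "B \<in> carrier_mat b b" "C \<in> carrier_mat a a" "D \<in> carrier_mat b b"
  shows "A = C" "B = D"
  using four_block_mat_inject(1,4)[OF assms(1)[unfolded diag_block_mat_pair], of a a b b] assms(2-5)
  by auto

lemma diag_pair_inverse:
  assumes A: "A \<in> carrier_mat a a" and B: "B \<in> carrier_mat b b"
  shows "invertible_mat (diag_block_mat [A, B]) \<longleftrightarrow> invertible_mat A \<and> invertible_mat B"
    and "invertible_mat A \<Longrightarrow> invertible_mat B \<Longrightarrow>
      mat_inv (diag_block_mat [A, B]) = diag_block_mat [mat_inv A, mat_inv B]"
proof -
  have "det (diag_block_mat [A, B]) = det A * det B"
    unfolding diag_block_mat_pair using A B by (intro det_four_block_mat_upper_right_zero[of _ a _ b]) auto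
  then show "invertible_mat (diag_block_mat [A, B]) \<longleftrightarrow> invertible_mat A \<and> invertible_mat B"
    using invertible_mat_iff_det[OF A] invertible_mat_iff_det[OF B]
      invertible_mat_iff_det[OF diag_pair_carrier[OF A B]] by simp
  assume "invertible_mat A" "invertible_mat B"
  note I = mat_inv_props[OF A this(1)] mat_inv_props[OF B this(2)]
  show "mat_inv (diag_block_mat [A, B]) = diag_block_mat [mat_inv A, mat_inv B]"
  proof (rule mat_inv_eqI)
    show "diag_block_mat [A, B] * diag_block_mat [mat_inv A, mat_inv B] = 1\<^sub>m (a + b)"
      unfolding diag_pair_mult[OF A B I(1,4)] I(2,5) by (simp add: diag_block_mat_pair)
  qed (use diag_pair_carrier A B I in auto)
qed

lemma append_cols_mult_diag_pair:
  assumes "X1 \<in> carrier_mat n a" "X2 \<in> carrier_mat n b" "A \<in> carrier_mat a a" "B \<in> carrier_mat b b"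
  shows "append_cols X1 X2 * diag_block_mat [A, B] = append_cols (X1 * A) (X2 * B)"
  unfolding diag_block_mat_pair using assms
  by (subst append_cols_mult_four_block[of _ n a _ b _ a _ b]) auto

section \<open>Spectra and the homogeneous Sylvester equation\<close>

lemma spectrum_similar:
  assumes "similar_mat A (B :: 'a :: field mat)"
  shows "spectrum A = spectrum B"
proof -
  from similar_matD[OF assms] obtain n P Q where "{A, B, P, Q} \<subseteq> carrier_mat n n" by blast
  then show ?thesis using spectrum_root_char_poly[of A n] spectrum_root_char_poly[of B n]
      char_poly_similar[OF assms] by simp
qed

text \<open>
  After passing to a Schur form \<open>B = P U R\<close> with \<open>U\<close> upper triangular, the equation
  becomes \<open>A Y' = Y' U\<close> for \<open>Y' = Y P\<close>. If the columns of \<open>Y'\<close> before the \<open>j\<close>-th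
  vanish, then the \<open>j\<close>-th column \<open>y\<close> satisfies \<open>A y = U\<^sub>j\<^sub>j y\<close>; as \<open>U\<^sub>j\<^sub>j\<close> is an eigenvalue of \<open>B\<close>, it is none of \<open>A\<close>, and
  \<open>y = 0\<close>.
\<close>

lemma sylvester_unique:
  assumes A: "A \<in> carrier_mat p p" and B: "B \<in> carrier_mat q q" and Y: "Y \<in> carrier_mat p q"
    and eq: "A * Y = Y * (B :: complex mat)"
    and disj: "spectrum A \<inter> spectrum B = {}"
  shows "Y = 0\<^sub>m p q"
proof -
  obtain es where "char_poly B = (\<Prod>e\<leftarrow>es. [:- e, 1:])" using char_poly_factorized[OF B] by blast
  from schur_decomposition_exists[OF B this]
  obtain U where U: "U \<in> carrier_mat q q" "upper_triangular U" "similar_mat B U" by blast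
  from similar_matD[OF U(3)] obtain m P R where
    m: "{B, U, P, R} \<subseteq> carrier_mat m m" "P * R = 1\<^sub>m m" "R * P = 1\<^sub>m m" "B = P * U * R" by blast
  have "m = q" using m B by auto
  note m = m[unfolded this]
  define Y' where "Y' = Y * P"
  have Y': "Y' \<in> carrier_mat p q" using Y m unfolding Y'_def by auto
  have P: "P \<in> carrier_mat q q" and R: "R \<in> carrier_mat q q" using m(1) by auto
  have "A * Y' = A * Y * P" using A Y P unfolding Y'_def by (simp add: mat_assoc)
  also have "\<dots> = Y' * U"
    unfolding eq m(4) Y'_def using Y U(1) P R m(3) by (simp add: mat_assoc)
  finally have AY: "A * Y' = Y' * U" .
  have col0: "col Y' j = 0\<^sub>v p" if "j < q" for j
    using that
  proof (induction j rule: less_induct)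
    case (less j)
    have YZ: "Y' $$ (r, i) = 0" if "r < p" "i < j" for r i
      using less.IH[OF \<open>i < j\<close>] that less.prems Y' by (metis carrier_matD index_col index_zero_vec(1) less_trans)
    have "A *\<^sub>v col Y' j = U $$ (j, j) \<cdot>\<^sub>v col Y' j"
    proof (rule eq_vecI)
      fix r assume "r < dim_vec (U $$ (j, j) \<cdot>\<^sub>v col Y' j)"
      then have r: "r < p" using Y' by simp
      have "(A *\<^sub>v col Y' j) $ r = (A * Y') $$ (r, j)"
        using r less.prems A Y' by simp
      also have "\<dots> = (\<Sum>i<q. Y' $$ (r, i) * U $$ (i, j))"
        unfolding AY using r less.prems U(1) Y' by (simp add: scalar_prod_def atLeast0LessThan)
      also have "\<dots> = (\<Sum>i<q. if i = j then Y' $$ (r, j) * U $$ (j, j) else 0)"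
      proof (rule sum.cong)
        fix i assume "i \<in> {..<q}"
        then show "Y' $$ (r, i) * U $$ (i, j) = (if i = j then Y' $$ (r, j) * U $$ (j, j) else 0)"
          using YZ[OF r, of i] upper_triangularD[OF U(2), of j i] U(1) by (cases i j rule: linorder_cases) auto
      qed simp
      also have "\<dots> = (U $$ (j, j) \<cdot>\<^sub>v col Y' j) $ r" using less.prems r Y' by simp
      finally show "(A *\<^sub>v col Y' j) $ r = (U $$ (j, j) \<cdot>\<^sub>v col Y' j) $ r" .
    qed (use A Y' in auto)
    moreover have "\<not> eigenvalue A (U $$ (j, j))"
    proof -
      have "U $$ (j, j) \<in> set (diag_mat U)"
        using less.prems U(1) unfolding diag_mat_def by auto
      then have "poly (char_poly U) (U $$ (j, j)) = 0"
        unfolding char_poly_upper_triangular[OF U(1,2)] by (simp add: poly_prod_list image_iff prod_list_zero_iff)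
      then have "eigenvalue B (U $$ (j, j))"
        using eigenvalue_root_char_poly[OF B] char_poly_similar[OF U(3)] by simp
      then show ?thesis using disj unfolding spectrum_def by auto
    qed
    moreover have "col Y' j \<in> carrier_vec p" using Y' by auto
    ultimately show ?case
      unfolding eigenvalue_def eigenvector_def using A by (metis carrier_matD(1))
  qed
  have "Y' = 0\<^sub>m p q"
  proof (rule eq_matI)
    fix i j assume "i < dim_row (0\<^sub>m p q :: complex mat)" "j < dim_col (0\<^sub>m p q :: complex mat)"
    then have ij: "i < p" "j < q" by auto
    then have "Y' $$ (i, j) = col Y' j $ i" using Y' by simp
    then show "Y' $$ (i, j) = 0\<^sub>m p q $$ (i, j)" unfolding col0[OF ij(2)] using ij by simp
  qed (use Y' in auto)
  then have "Y' * R = 0\<^sub>m p q" using R by simp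
  moreover have "Y' * R = Y" unfolding Y'_def using m(2) P R Y by (simp add: mat_assoc)
  ultimately show ?thesis by simp
qed

section \<open>The pairing of a standard pair\<close>

text \<open>
  The matrix whose inverse is the parameter \<open>S\<close> of the system; applied to \<open>(X1, T1)\<close> it is
  \<open>S1\<inverse>\<close>.
\<close>

definition pairing ::
  "star_op \<Rightarrow> complex \<Rightarrow> complex mat \<Rightarrow> complex mat \<Rightarrow> complex mat \<Rightarrow> complex mat" where
  "pairing s \<epsilon> A1 X T = \<epsilon> \<cdot>\<^sub>m (mat_star s X * A1 * X * mat_inv T)
     - mat_star s (mat_inv T) * mat_star s X * mat_star s A1 * X"

text \<open>
  The star exchanges the two summands of the pairing, up to the factor \<open>\<epsilon>\<close>.
\<close>

lemma mat_star_pairing: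
  assumes eps: "\<epsilon> \<in> {1, -1}" and A1: "A1 \<in> carrier_mat n n" and X: "X \<in> carrier_mat n m"
    and T: "T \<in> carrier_mat m m" "invertible_mat T"
  shows "mat_star s (pairing s \<epsilon> A1 X T) = (- \<epsilon>) \<cdot>\<^sub>m pairing s \<epsilon> A1 X T"
proof -
  note I = mat_inv_props[OF T]
  let ?P = "mat_star s (mat_inv T) * mat_star s X * mat_star s A1 * X"
  let ?Q = "mat_star s X * A1 * X * mat_inv T"
  have PQ: "mat_star s ?P = ?Q" "mat_star s ?Q = ?P"
    using A1 X T I by (simp_all add: mat_star_simps mat_ring)
  have "mat_star s (pairing s \<epsilon> A1 X T) = \<epsilon> \<cdot>\<^sub>m ?P - ?Q"
    unfolding pairing_def using A1 X T I eps PQ by (subst mat_star_minus) (auto simp: mat_star_smult)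
  also have "\<dots> = (- \<epsilon>) \<cdot>\<^sub>m pairing s \<epsilon> A1 X T"
    unfolding pairing_def by (rule eq_matI) (use A1 X T I eps_square[OF eps] in \<open>auto simp: algebra_simps\<close>)
  finally show ?thesis .
qed

text \<open>
  The factorization \<open>W = U\<^sup>\<star> J U\<close>: the pairing is a congruence transform of a matrix that
  depends on \<open>\<epsilon>\<close> and \<open>A1\<close> only, so it is nonsingular as soon as \<open>U\<close> and \<open>A1\<close> are.
\<close>

lemma pairing_factorization:
  assumes A1: "A1 \<in> carrier_mat n n" and X: "X \<in> carrier_mat n m"
    and T: "T \<in> carrier_mat m m" "invertible_mat T"
  shows "pairing s \<epsilon> A1 X T =
    mat_star s (X @\<^sub>r (- (X * mat_inv T)))
      * four_block_mat (0\<^sub>m n n) (- (\<epsilon> \<cdot>\<^sub>m A1)) (mat_star s A1) (0\<^sub>m n n)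
      * (X @\<^sub>r (- (X * mat_inv T)))"
proof -
  note I = mat_inv_props[OF T]
  let ?Y = "- (X * mat_inv T)"
  have Y: "?Y \<in> carrier_mat n m" using X I by auto
  have "mat_star s (X @\<^sub>r ?Y) * four_block_mat (0\<^sub>m n n) (- (\<epsilon> \<cdot>\<^sub>m A1)) (mat_star s A1) (0\<^sub>m n n)
    = append_cols (mat_star s X * 0\<^sub>m n n + mat_star s ?Y * mat_star s A1)
        (mat_star s X * (- (\<epsilon> \<cdot>\<^sub>m A1)) + mat_star s ?Y * 0\<^sub>m n n)"
    using X Y A1 I by (subst mat_star_append_rows, simp, subst append_cols_mult_four_block) auto
  also have "mat_star s X * 0\<^sub>m n n + mat_star s ?Y * mat_star s A1 = mat_star s ?Y * mat_star s A1"
    by (rule eq_matI) (use X Y A1 in auto)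
  also have "mat_star s X * (- (\<epsilon> \<cdot>\<^sub>m A1)) + mat_star s ?Y * 0\<^sub>m n n = - (\<epsilon> \<cdot>\<^sub>m (mat_star s X * A1))"
    using X Y A1 I by (simp add: mat_mult_uminus mat_mult_smult) (rule eq_matI; auto)
  also have "append_cols (mat_star s ?Y * mat_star s A1) (- (\<epsilon> \<cdot>\<^sub>m (mat_star s X * A1))) * (X @\<^sub>r ?Y)
     = mat_star s ?Y * mat_star s A1 * X + (- (\<epsilon> \<cdot>\<^sub>m (mat_star s X * A1))) * ?Y"
    by (rule append_cols_mult_append_rows) (use X Y A1 I in auto)
  also have "\<dots> = - (mat_star s (mat_inv T) * mat_star s X * mat_star s A1 * X)
     + \<epsilon> \<cdot>\<^sub>m (mat_star s X * A1 * X * mat_inv T)"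
    using X A1 I by (simp add: mat_ring mat_star_simps)
  also have "\<dots> = pairing s \<epsilon> A1 X T"
    unfolding pairing_def by (rule eq_matI) (use X A1 I in auto)
  finally show ?thesis by simp
qed

text \<open>
  Multiplying the equation by \<open>X\<^sup>\<star>\<close> and taking the star of the result yields two relations, one
  with the term \<open>X\<^sup>\<star> A0 X\<close> and one with \<open>\<epsilon> X\<^sup>\<star> A0 X\<close>, because \<open>A0\<^sup>\<star> = \<epsilon> A0\<close>. Eliminating this
  term leaves \<open>T\<^sup>\<star> W T = W\<close>.
\<close>

lemma pairing_invariant:
  assumes eps: "\<epsilon> \<in> {1, -1}" and A1: "A1 \<in> carrier_mat n n" and A0: "A0 \<in> carrier_mat n n"
    and star_A0: "mat_star s A0 = \<epsilon> \<cdot>\<^sub>m A0"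
    and X: "X \<in> carrier_mat n m" and T: "T \<in> carrier_mat m m" "invertible_mat T"
    and sol: "mat_star s A1 * X * T + A0 * X + \<epsilon> \<cdot>\<^sub>m (A1 * X * mat_inv T) = 0\<^sub>m n m"
  shows "mat_star s T * pairing s \<epsilon> A1 X T * T = pairing s \<epsilon> A1 X T"
proof -
  note I = mat_inv_props[OF T]
  let ?a = "mat_star s X * mat_star s A1 * X * T" and ?b = "mat_star s X * A0 * X"
  let ?c = "mat_star s X * A1 * X * mat_inv T"
  let ?d = "mat_star s T * mat_star s X * A1 * X"
  let ?e = "mat_star s (mat_inv T) * mat_star s X * mat_star s A1 * X"
  have c: "?a \<in> carrier_mat m m" "?b \<in> carrier_mat m m" "?c \<in> carrier_mat m m" "?d \<in> carrier_mat m m"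
    "?e \<in> carrier_mat m m" using A1 A0 X T I by auto
  have "mat_star s X * (mat_star s A1 * X * T + A0 * X + \<epsilon> \<cdot>\<^sub>m (A1 * X * mat_inv T)) = 0\<^sub>m m m"
    unfolding sol using X by simp
  then have 1: "?a + ?b + \<epsilon> \<cdot>\<^sub>m ?c = 0\<^sub>m m m"
    using A1 A0 X T I by (simp add: mat_ring)
  have "mat_star s (?a + ?b + \<epsilon> \<cdot>\<^sub>m ?c) = 0\<^sub>m m m" unfolding 1 by simp
  then have 2: "?d + \<epsilon> \<cdot>\<^sub>m ?b + \<epsilon> \<cdot>\<^sub>m ?e = 0\<^sub>m m m"
    using A1 A0 X T I eps by (simp add: mat_star_simps star_A0 mat_ring)
  have TT: "mat_star s T * mat_star s (mat_inv T) = 1\<^sub>m m"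
    using I T by (simp flip: mat_star_mult)
  have d: "mat_star s T * ?c * T = ?d"
    using A1 X T I by (simp add: mat_ring)
  have "mat_star s T * ?e * T = mat_star s T * mat_star s (mat_inv T) * ?a"
    using A1 X T I by (simp add: mat_ring)
  then have a: "mat_star s T * ?e * T = ?a" unfolding TT left_mult_one_mat[OF c(1)] .
  have "mat_star s T * pairing s \<epsilon> A1 X T * T = \<epsilon> \<cdot>\<^sub>m (mat_star s T * ?c * T) - mat_star s T * ?e * T"
    unfolding pairing_def using A1 X T I
    by (simp add: mat_mult_minus mat_minus_mult mat_smult_mult mat_mult_smult)
  also have "\<dots> = \<epsilon> \<cdot>\<^sub>m ?d - ?a" unfolding a d ..
  also have "\<dots> = \<epsilon> \<cdot>\<^sub>m ?c - ?e"
  proof (rule eq_matI)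
    fix i j assume "i < dim_row (\<epsilon> \<cdot>\<^sub>m ?c - ?e)" "j < dim_col (\<epsilon> \<cdot>\<^sub>m ?c - ?e)"
    then have ij: "i < m" "j < m" using c by auto
    obtain a b c d e where abbr: "?a $$ (i, j) = a" "?b $$ (i, j) = b" "?c $$ (i, j) = c"
      "?d $$ (i, j) = d" "?e $$ (i, j) = e" by blast
    note dims = c[THEN carrier_matD(1)] c[THEN carrier_matD(2)]
    have "a + b + \<epsilon> * c = 0"
      using arg_cong[OF 1, of "\<lambda>M. M $$ (i, j)"] ij dims abbr by (simp del: index_mult_mat)
    moreover have "d + \<epsilon> * b + \<epsilon> * e = 0"
      using arg_cong[OF 2, of "\<lambda>M. M $$ (i, j)"] ij dims abbr by (simp del: index_mult_mat)
    moreover have "\<epsilon> * (d + \<epsilon> * b + \<epsilon> * e) = \<epsilon> * d + b + e"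
      using eps_square[OF eps] by (simp add: algebra_simps flip: mult.assoc)
    \<comment> \<open>The combination of both relations in which the term with \<open>A0\<close> cancels, by \<open>\<epsilon> * \<epsilon> = 1\<close>.\<close>
    moreover have "\<epsilon> * d - a - (\<epsilon> * c - e) = (\<epsilon> * d + b + e) - (a + b + \<epsilon> * c)"
      by (simp add: algebra_simps)
    ultimately have "\<epsilon> * d - a = \<epsilon> * c - e" by simp
    then show "(\<epsilon> \<cdot>\<^sub>m ?d - ?a) $$ (i, j) = (\<epsilon> \<cdot>\<^sub>m ?c - ?e) $$ (i, j)"
      using ij dims abbr by (simp del: index_mult_mat)
  qed (use A1 X T I in auto)
  finally show ?thesis unfolding pairing_def .
qed

section \<open>Spectral triples and palindromic systems\<close>

text \<open>
  The last two conditions say that \<open>U S U\<^sup>\<star> = J\<inverse>\<close>, given the symmetries of \<open>S\<close>. In particular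
  they force \<open>S\<close>, \<open>A1\<close> and \<open>U\<close> to be nonsingular.
\<close>

definition spectral_triple ::
  "star_op \<Rightarrow> complex \<Rightarrow> nat \<Rightarrow> complex mat \<Rightarrow> complex mat \<Rightarrow> complex mat \<Rightarrow> complex mat \<Rightarrow> bool" where
  "spectral_triple s \<epsilon> n A1 X T S \<longleftrightarrow>
     X \<in> carrier_mat n (2 * n) \<and> T \<in> carrier_mat (2 * n) (2 * n) \<and> invertible_mat T \<and>
     S \<in> carrier_mat (2 * n) (2 * n) \<and> mat_star s S = (- \<epsilon>) \<cdot>\<^sub>m S \<and> S = T * S * mat_star s T \<and>
     X * S * mat_star s X = 0\<^sub>m n n \<and>
     A1 * (X * mat_inv T * S * mat_star s X) = \<epsilon> \<cdot>\<^sub>m 1\<^sub>m n"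

text \<open>
  From \<open>W = U\<^sup>\<star> J U\<close> and \<open>S = W\<inverse>\<close> one gets \<open>U S U\<^sup>\<star> J U = U\<close>, hence \<open>U S U\<^sup>\<star> = J\<inverse>\<close>; comparing
  blocks gives the conditions on \<open>X S X\<^sup>\<star>\<close> and \<open>X T\<inverse> S X\<^sup>\<star>\<close>. Multiplying the quadratic equation
  by \<open>T\<inverse> S X\<^sup>\<star>\<close> then isolates \<open>A0\<close>.
\<close>

lemma spectral_triple_of_standard_pair:
  assumes eps: "\<epsilon> \<in> {1, -1}" and Q: "regular_pal_system s \<epsilon> n A1 A0"
    and pair: "standard_pair s \<epsilon> n A1 A0 X T"
  defines "W \<equiv> pairing s \<epsilon> A1 X T"
  shows "invertible_mat W" "spectral_triple s \<epsilon> n A1 X T (mat_inv W)"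
    "A0 = - (A1 * (X * mat_inv T * mat_inv T * mat_inv W * mat_star s X) * A1)"
    "mat_star s T * W * T = W"
proof -
  have X: "X \<in> carrier_mat n (2 * n)" and T: "T \<in> carrier_mat (2 * n) (2 * n)" "invertible_mat T"
    and invU: "invertible_mat (X @\<^sub>r (- (X * mat_inv T)))"
    and sol: "mat_star s A1 * X * (T ^\<^sub>m 2) + A0 * X * T + \<epsilon> \<cdot>\<^sub>m (A1 * X) = 0\<^sub>m n (2 * n)"
    using pair unfolding standard_pair_def by auto
  have A1: "A1 \<in> carrier_mat n n" "invertible_mat A1" and A0: "A0 \<in> carrier_mat n n"
    and star_A0: "mat_star s A0 = \<epsilon> \<cdot>\<^sub>m A0"
    using Q unfolding regular_pal_system_def by auto
  note I = mat_inv_props[OF T] and IA = mat_inv_props[OF A1] and ee = eps_square[OF eps]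
  let ?Xs = "mat_star s X" and ?Ti = "mat_inv T" and ?As = "mat_star s A1"
  let ?Ai = "mat_inv A1"
  have sol': "?As * X * T + A0 * X + \<epsilon> \<cdot>\<^sub>m (A1 * X * ?Ti) = 0\<^sub>m n (2 * n)"
  proof -
    have "?As * X * T + A0 * X + \<epsilon> \<cdot>\<^sub>m (A1 * X * ?Ti)
      = (?As * X * (T ^\<^sub>m 2) + A0 * X * T + \<epsilon> \<cdot>\<^sub>m (A1 * X)) * ?Ti"
      unfolding pow_mat_two[OF T(1)] using A1 A0 X T I by (simp add: mat_ring)
    then show ?thesis unfolding sol using I by simp
  qed
  define Y where "Y = - (X * ?Ti)"
  define U where "U = X @\<^sub>r Y"
  define J where "J = four_block_mat (0\<^sub>m n n) (- (\<epsilon> \<cdot>\<^sub>m A1)) ?As (0\<^sub>m n n)"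
  define K where "K = four_block_mat (0\<^sub>m n n) (mat_star s ?Ai) (- (\<epsilon> \<cdot>\<^sub>m ?Ai)) (0\<^sub>m n n)"
  have Y: "Y \<in> carrier_mat n (2 * n)" using X I unfolding Y_def by auto
  have U: "U \<in> carrier_mat (2 * n) (2 * n)" "invertible_mat U"
  proof -
    show "U \<in> carrier_mat (2 * n) (2 * n)" unfolding U_def using X Y by auto
    show "invertible_mat U" using invU unfolding U_def Y_def .
  qed
  have JK: "J \<in> carrier_mat (2 * n) (2 * n)" "K \<in> carrier_mat (2 * n) (2 * n)"
    unfolding J_def K_def using A1 IA by (auto simp: mult_2)
  have KJ: "K * J = 1\<^sub>m (2 * n)"
    unfolding J_def K_def mult_2
  proof (rule antidiagonal_block_mult)
    show "mat_star s ?Ai * ?As = 1\<^sub>m n" using IA A1 by (simp flip: mat_star_mult)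
    show "- (\<epsilon> \<cdot>\<^sub>m ?Ai) * - (\<epsilon> \<cdot>\<^sub>m A1) = 1\<^sub>m n" using IA A1 ee by (simp add: mat_ring mat_uminus_smult mat_one_smult)
  qed (use A1 IA in auto)
  have J_K: "J * K = 1\<^sub>m (2 * n)" by (rule mat_mult_left_right_inverse[OF JK(2,1) KJ])
  have W_eq: "W = mat_star s U * J * U"
    unfolding W_def U_def Y_def J_def by (rule pairing_factorization[OF A1(1) X T])
  have W: "W \<in> carrier_mat (2 * n) (2 * n)" unfolding W_eq using U JK by auto
  note Us = mat_star_carrier[OF U(1), of s]
  have "det J \<noteq> 0" using invertible_mat_iff_det[OF JK(1)] invertible_matI[OF JK J_K] by simp
  moreover have "det U \<noteq> 0" "det (mat_star s U) \<noteq> 0"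
    using U invertible_mat_iff_det[OF U(1)] invertible_mat_iff_det[OF Us] invertible_mat_star[OF U] by auto
  moreover have "det W = det (mat_star s U * J) * det U"
    unfolding W_eq by (rule det_mult) (use U JK in auto)
  ultimately have "det W \<noteq> 0" using det_mult[OF Us JK(1)] by simp
  then show invW: "invertible_mat W" using invertible_mat_iff_det[OF W] by simp
  note IW = mat_inv_props[OF W invW]
  define S where "S = mat_inv W"
  note IW = IW[folded S_def]
  have star_W: "mat_star s W = (- \<epsilon>) \<cdot>\<^sub>m W" unfolding W_def by (rule mat_star_pairing[OF eps A1(1) X T])
  show TWT: "mat_star s T * W * T = W"
    unfolding W_def by (rule pairing_invariant[OF eps A1(1) A0 star_A0 X T sol'])
  have star_S: "mat_star s S = (- \<epsilon>) \<cdot>\<^sub>m S"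
  proof -
    have "mat_star s S = mat_inv ((- \<epsilon>) \<cdot>\<^sub>m W)"
      unfolding S_def star_W[symmetric] using invertible_mat_star[OF W invW] by simp
    also have "\<dots> = (- \<epsilon>) \<cdot>\<^sub>m S"
      by (rule mat_inv_eqI[of _ "2 * n"]) (use W IW ee in \<open>auto simp: mat_ring mat_one_smult\<close>)
    finally show ?thesis .
  qed
  have STS: "S = T * S * mat_star s T"
  proof -
    have "T * S * mat_star s T * W * T = T * S * (mat_star s T * W * T)"
      using T IW W by (simp add: mat_assoc)
    also have "\<dots> = 1\<^sub>m (2 * n) * T" unfolding TWT using T IW W by (simp add: mat_assoc)
    finally have *: "T * S * mat_star s T * W * T = 1\<^sub>m (2 * n) * T" .
    have TST: "T * S * mat_star s T \<in> carrier_mat (2 * n) (2 * n)" using T IW(1) by auto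
    have "T * S * mat_star s T * W = 1\<^sub>m (2 * n)"
      by (rule mult_invertible_right_cancel[OF T(2,1) _ _ *]) (use TST W in auto)
    also have "\<dots> = S * W" using IW by simp
    finally have "T * S * mat_star s T * W = S * W" .
    from mult_invertible_right_cancel[OF invW W TST IW(1) this] show ?thesis by simp
  qed
  have "U * S * mat_star s U * J * U = U * (S * W)"
    unfolding W_eq using U JK IW by (simp add: mat_assoc)
  also have "\<dots> = 1\<^sub>m (2 * n) * U" unfolding IW using U by simp
  finally have *: "U * S * mat_star s U * J * U = 1\<^sub>m (2 * n) * U" .
  have "U * S * mat_star s U * J = 1\<^sub>m (2 * n)"
    by (rule mult_invertible_right_cancel[OF U(2,1) _ _ *]) (use U JK IW(1) Us in auto)
  then have "U * S * mat_star s U * J * K = K" using JK by simp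
  then have "U * S * mat_star s U = K" using JK J_K U IW Us by (simp add: mat_assoc)
  then have blocks: "four_block_mat (X * S * ?Xs) (X * S * mat_star s Y) (Y * S * ?Xs) (Y * S * mat_star s Y)
    = four_block_mat (0\<^sub>m n n) (mat_star s ?Ai) (- (\<epsilon> \<cdot>\<^sub>m ?Ai)) (0\<^sub>m n n)"
    unfolding U_def K_def stacked_gram[OF X Y IW(1)] .
  have c: "X * S * ?Xs \<in> carrier_mat n n" "X * S * mat_star s Y \<in> carrier_mat n n"
    "Y * S * ?Xs \<in> carrier_mat n n" "Y * S * mat_star s Y \<in> carrier_mat n n"
    "mat_star s ?Ai \<in> carrier_mat n n" "- (\<epsilon> \<cdot>\<^sub>m ?Ai) \<in> carrier_mat n n" "0\<^sub>m n n \<in> carrier_mat n n"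
    using X Y IW IA by auto
  have XSX: "X * S * ?Xs = 0\<^sub>m n n" and YSX: "Y * S * ?Xs = - (\<epsilon> \<cdot>\<^sub>m ?Ai)"
    using four_block_mat_inject(1,3)[OF blocks c(1-4) c(7,5,6,7)] by auto
  have P: "X * ?Ti * S * ?Xs = \<epsilon> \<cdot>\<^sub>m ?Ai"
  proof -
    have "Y * S * ?Xs = - (X * ?Ti * S * ?Xs)" unfolding Y_def using X I IW by (simp add: mat_ring)
    then show ?thesis using YSX by (metis uminus_uminus_mat)
  qed
  show "spectral_triple s \<epsilon> n A1 X T (mat_inv W)"
    unfolding spectral_triple_def S_def[symmetric] P
    using X T IW star_S STS XSX A1 IA by (simp add: mat_mult_smult)
  let ?V = "X * ?Ti * ?Ti * S * ?Xs"
  have V: "?V \<in> carrier_mat n n" using X I IW by auto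
  have "0\<^sub>m n n = (?As * X * T + A0 * X + \<epsilon> \<cdot>\<^sub>m (A1 * X * ?Ti)) * (?Ti * S * ?Xs * (\<epsilon> \<cdot>\<^sub>m A1))"
    unfolding sol' using X I IW A1 by simp
  also have "\<dots> = ?As * (X * (T * (?Ti * S)) * ?Xs) * (\<epsilon> \<cdot>\<^sub>m A1) + A0 * (X * ?Ti * S * ?Xs) * (\<epsilon> \<cdot>\<^sub>m A1)
      + A1 * ?V * A1"
    using X I IW A1 A0 T by (simp add: mat_ring ee mat_one_smult)
  also have "T * (?Ti * S) = S" using mat_cancel_left[OF I(2)] I T IW by simp
  also have "?As * (X * S * ?Xs) * (\<epsilon> \<cdot>\<^sub>m A1) = 0\<^sub>m n n" unfolding XSX using A1 by simp
  also have "A0 * (X * ?Ti * S * ?Xs) * (\<epsilon> \<cdot>\<^sub>m A1) = A0"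
    unfolding P using A0 A1 IA by (simp add: mat_ring ee mat_one_smult)
  finally have "A0 + A1 * ?V * A1 = 0\<^sub>m n n" using A0 by simp
  then show "A0 = - (A1 * (X * ?Ti * ?Ti * mat_inv W * ?Xs) * A1)"
    unfolding S_def[symmetric] by (intro mat_add_eq_zero[of _ n n]) (use A0 A1 V in auto)
qed

text \<open>
  The conditions on the triple are equivalent to \<open>U S U\<^sup>\<star> = J\<inverse>\<close>, so \<open>U\<close> is nonsingular. For the
  quadratic equation, start from the other candidate \<open>B = A1\<^sup>\<star> (X T\<^sup>2 S X\<^sup>\<star>) A1\<^sup>\<star>\<close> for the middle
  coefficient and let \<open>R\<close> be the residual \<open>A1\<^sup>\<star> X T + B X + \<epsilon> A1 X T\<inverse>\<close>. Both \<open>R S X\<^sup>\<star>\<close> and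
  \<open>R T S X\<^sup>\<star>\<close> vanish, hence \<open>R S U\<^sup>\<star> = 0\<close> and \<open>R = 0\<close>. Now \<open>R T\<inverse> S X\<^sup>\<star> = 0\<close> identifies \<open>B\<close> with
  \<open>A0 = - A1 (X T\<^sup>-\<^sup>2 S X\<^sup>\<star>) A1\<close>, and since \<open>\<star>\<close> turns one expression into \<open>\<epsilon>\<close> times the other,
  \<open>A0\<^sup>\<star> = \<epsilon> A0\<close>.
\<close>

lemma system_of_spectral_triple:
  assumes eps: "\<epsilon> \<in> {1, -1}" and A1: "A1 \<in> carrier_mat n n"
    and triple: "spectral_triple s \<epsilon> n A1 X T S"
    and A0: "A0 = - (A1 * (X * mat_inv T * mat_inv T * S * mat_star s X) * A1)"
  shows "regular_pal_system s \<epsilon> n A1 A0" "standard_pair s \<epsilon> n A1 A0 X T"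
proof -
  note d = triple[unfolded spectral_triple_def]
  have X: "X \<in> carrier_mat n (2 * n)" and T: "T \<in> carrier_mat (2 * n) (2 * n)" "invertible_mat T"
    and S: "S \<in> carrier_mat (2 * n) (2 * n)"
    and star_S: "mat_star s S = (- \<epsilon>) \<cdot>\<^sub>m S" and STS: "T * S * mat_star s T = S"
    and XSX: "X * S * mat_star s X = 0\<^sub>m n n"
    and AP: "A1 * (X * mat_inv T * S * mat_star s X) = \<epsilon> \<cdot>\<^sub>m 1\<^sub>m n"
    using d by auto
  note I = mat_inv_props[OF T]
  note ee = eps_square[OF eps]
  let ?Xs = "mat_star s X" and ?Ti = "mat_inv T" and ?As = "mat_star s A1"
  have Ts: "mat_star s T * mat_star s ?Ti = 1\<^sub>m (2*n)" "mat_star s ?Ti * mat_star s T = 1\<^sub>m (2*n)"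
    using I T by (simp_all flip: mat_star_mult)
  have TiS: "?Ti * S = S * mat_star s T"
  proof -
    have "?Ti * S = ?Ti * (T * S * mat_star s T)" unfolding STS ..
    also have "\<dots> = S * mat_star s T"
      using I S T by (simp add: mat_assoc mat_cancel_left[OF I(3)])
    finally show ?thesis .
  qed
  have STi: "S * mat_star s ?Ti = T * S"
  proof -
    have "S * mat_star s ?Ti = (T * S * mat_star s T) * mat_star s ?Ti" unfolding STS ..
    also have "\<dots> = T * S"
      using I S T Ts by (simp add: mat_assoc)
    finally show ?thesis .
  qed
  define P where "P = X * ?Ti * S * ?Xs"
  define P' where "P' = X * T * S * ?Xs"
  define V where "V = X * ?Ti * ?Ti * S * ?Xs"
  define V' where "V' = X * T * T * S * ?Xs"
  have car: "P \<in> carrier_mat n n" "P' \<in> carrier_mat n n" "V \<in> carrier_mat n n" "V' \<in> carrier_mat n n"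
    "?As \<in> carrier_mat n n"
    using X T S I A1 unfolding P_def P'_def V_def V'_def by auto
  \<comment> \<open>\<open>S T\<^sup>-\<^sup>\<star> = T S\<close> turns the negative power of \<open>T\<close> in the star of \<open>P\<close> into a positive one.\<close>
  have star_P: "mat_star s P = (- \<epsilon>) \<cdot>\<^sub>m P'"
  proof -
    have "mat_star s P = (- \<epsilon>) \<cdot>\<^sub>m (X * (S * mat_star s ?Ti) * ?Xs)"
      unfolding P_def using X S I by (simp add: mat_star_mult star_S mat_ring)
    then show ?thesis unfolding STi P'_def using X S T by (simp add: mat_ring)
  qed
  have star_V': "mat_star s V' = (- \<epsilon>) \<cdot>\<^sub>m V"
  proof -
    have "mat_star s V' = (- \<epsilon>) \<cdot>\<^sub>m (X * (S * mat_star s T * mat_star s T) * ?Xs)"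
      unfolding V'_def using X S T by (simp add: mat_star_mult star_S mat_ring)
    also have "S * mat_star s T * mat_star s T = ?Ti * S * mat_star s T"
      unfolding TiS ..
    also have "\<dots> = ?Ti * (S * mat_star s T)"
      using I S T by (simp add: mat_assoc)
    also have "\<dots> = ?Ti * ?Ti * S"
      unfolding TiS[symmetric] using I S T by (simp add: mat_assoc)
    finally show ?thesis unfolding V_def using X S I by (simp add: mat_ring)
  qed
  have A1P: "A1 * P = \<epsilon> \<cdot>\<^sub>m 1\<^sub>m n" using AP unfolding P_def .
  have A1Pe: "A1 * (\<epsilon> \<cdot>\<^sub>m P) = 1\<^sub>m n"
    using A1 car by (simp add: mat_ring A1P ee mat_one_smult)
  have PA1: "(\<epsilon> \<cdot>\<^sub>m P) * A1 = 1\<^sub>m n"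
    by (rule mat_mult_left_right_inverse[OF A1 _ A1Pe]) (use car in auto)
  have AsP': "?As * P' = - 1\<^sub>m n"
  proof -
    have "mat_star s ((\<epsilon> \<cdot>\<^sub>m P) * A1) = ?As * (\<epsilon> \<cdot>\<^sub>m ((- \<epsilon>) \<cdot>\<^sub>m P'))"
      using A1 car eps by (simp add: mat_star_mult mat_star_smult star_P)
    also have "\<dots> = - (?As * P')"
      using A1 car ee by (simp add: mat_mult_smult mat_smult_smult mat_uminus_smult)
    finally have "- (?As * P') = 1\<^sub>m n" unfolding PA1 by simp
    then show ?thesis by (metis uminus_uminus_mat)
  qed
  have AsP'': "?As * (- P') = 1\<^sub>m n" using A1 car by (simp add: mat_mult_uminus AsP')
  have P'As: "(- P') * ?As = 1\<^sub>m n"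
    by (rule mat_mult_left_right_inverse[OF _ _ AsP'']) (use car in auto)
  define Y where "Y = - (X * ?Ti)"
  have Y: "Y \<in> carrier_mat n (2 * n)" using X I unfolding Y_def by auto
  have Ys: "mat_star s Y = - (mat_star s ?Ti * ?Xs)"
    unfolding Y_def using X I by (simp add: mat_star_uminus mat_star_mult)
  have XSY: "X * S * mat_star s Y = - P'"
  proof -
    have "X * S * mat_star s Y = - (X * (S * mat_star s ?Ti) * ?Xs)"
      unfolding Ys using X I S by (simp add: mat_ring)
    then show ?thesis unfolding STi P'_def using X S T by (simp add: mat_ring)
  qed
  have YSX: "Y * S * ?Xs = - P"
    unfolding Y_def P_def using X S I by (simp add: mat_ring)
  have YSY: "Y * S * mat_star s Y = 0\<^sub>m n n"
  proof -
    have "Y * S * mat_star s Y = X * (?Ti * (S * mat_star s ?Ti)) * ?Xs"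
      unfolding Ys unfolding Y_def using X I S by (simp add: mat_ring)
    also have "?Ti * (S * mat_star s ?Ti) = S"
      unfolding STi using mat_cancel_left[OF I(3)] I T S by simp
    finally show ?thesis using XSX by simp
  qed
  define U where "U = X @\<^sub>r Y"
  have U: "U \<in> carrier_mat (2 * n) (2 * n)" using X Y unfolding U_def by auto
  define J where "J = four_block_mat (0\<^sub>m n n) (- (\<epsilon> \<cdot>\<^sub>m A1)) ?As (0\<^sub>m n n)"
  have J: "J \<in> carrier_mat (2 * n) (2 * n)" unfolding J_def using A1 by (auto simp: mult_2)
  have USU: "U * S * mat_star s U = four_block_mat (0\<^sub>m n n) (- P') (- P) (0\<^sub>m n n)"
    unfolding U_def stacked_gram[OF X Y S] XSX XSY YSX YSY ..
  have "U * S * mat_star s U * J = 1\<^sub>m (n + n)"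
    unfolding USU J_def
  proof (rule antidiagonal_block_mult)
    show "- P * - (\<epsilon> \<cdot>\<^sub>m A1) = 1\<^sub>m n"
      using PA1 car A1 by (simp add: mat_ring mat_uminus_smult)
  qed (use car A1 P'As in auto)
  then have 1: "U * (S * mat_star s U * J) = 1\<^sub>m (2 * n)"
    using U S J by (simp add: mat_assoc mult_2)
  have invU: "invertible_mat U"
    by (rule invertible_matI[OF U _ 1]) (use S U J in auto)
  have 2: "S * mat_star s U * J * U = 1\<^sub>m (2 * n)"
    by (rule mat_mult_left_right_inverse[OF U _ 1]) (use S U J in auto)
  define B where "B = ?As * V' * ?As"
  have B: "B \<in> carrier_mat n n" unfolding B_def using car by auto
  define R where "R = ?As * X * T + B * X + \<epsilon> \<cdot>\<^sub>m (A1 * X * ?Ti)"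
  have R: "R \<in> carrier_mat n (2 * n)" unfolding R_def using A1 X I B T by auto
  have RSX: "R * S * ?Xs = 0\<^sub>m n n"
  proof -
    have "R * S * ?Xs = ?As * P' + B * (X * S * ?Xs) + \<epsilon> \<cdot>\<^sub>m (A1 * P)"
      unfolding R_def P_def P'_def using A1 X I B T S by (simp add: mat_ring)
    also have "\<dots> = 0\<^sub>m n n" unfolding AsP' XSX A1P
      by (rule eq_matI) (use B ee in \<open>auto simp: mat_smult_smult\<close>)
    finally show ?thesis .
  qed
  have RTSX: "R * (T * S) * ?Xs = 0\<^sub>m n n"
  proof -
    have "R * (T * S) * ?Xs = ?As * V' + B * P' + \<epsilon> \<cdot>\<^sub>m (A1 * (X * (?Ti * (T * S)) * ?Xs))"
      unfolding R_def P'_def V'_def using A1 X I B T S by (simp add: mat_ring)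
    also have "?Ti * (T * S) = S" using mat_cancel_left[OF I(3)] I T S by simp
    also have "B * P' = - (?As * V')" unfolding B_def using car A1
      by (simp add: mat_assoc AsP' mat_mult_uminus)
    finally show ?thesis unfolding XSX using car A1 by (auto intro!: eq_matI)
  qed
  have "R * S * mat_star s Y = 0\<^sub>m n n"
  proof -
    have "R * S * mat_star s Y = - (R * (S * mat_star s ?Ti) * ?Xs)"
      unfolding Ys using R X I S by (simp add: mat_ring)
    then show ?thesis unfolding STi RTSX by (auto intro!: eq_matI)
  qed
  then have RSU: "R * S * mat_star s U = 0\<^sub>m n (2 * n)"
    unfolding U_def using X Y R S RSX
    by (subst mat_star_append_rows) (auto simp: mult_append_cols[where n = n and a = "2 * n" and b = n and c = n] intro!: eq_matI)
  have "R = R * (S * mat_star s U * J * U)" unfolding 2 using R by simp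
  also have "\<dots> = R * S * mat_star s U * (J * U)" using R S U J by (simp add: mat_assoc)
  also have "\<dots> = 0\<^sub>m n (2 * n)" unfolding RSU using J U by simp
  finally have R0: "R = 0\<^sub>m n (2 * n)" .
  have B_eq: "B = A0"
  proof -
    have "R * ?Ti * S * ?Xs = ?As * (X * (T * (?Ti * S)) * ?Xs) + B * P + \<epsilon> \<cdot>\<^sub>m (A1 * V)"
      unfolding R_def P_def V_def using A1 X I B T S
      by (simp add: mat_ring mat_cancel_left[OF I(2)])
    also have "T * (?Ti * S) = S" using mat_cancel_left[OF I(2)] I T S by simp
    finally have "0\<^sub>m n n = B * P + \<epsilon> \<cdot>\<^sub>m (A1 * V)"
      unfolding R0 XSX using A1 B car X I S by simp
    then have "0\<^sub>m n n = (B * P + \<epsilon> \<cdot>\<^sub>m (A1 * V)) * (\<epsilon> \<cdot>\<^sub>m A1)"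
      using A1 by (simp flip: \<open>0\<^sub>m n n = _\<close>)
    also have "\<dots> = B * ((\<epsilon> \<cdot>\<^sub>m P) * A1) + A1 * V * A1"
      using A1 B car by (simp add: mat_ring ee mat_one_smult)
    finally have "B + A1 * V * A1 = 0\<^sub>m n n" unfolding PA1 using B by simp
    then show ?thesis
      unfolding A0 V_def[symmetric] by (intro mat_add_eq_zero[of _ n n]) (use A1 B car in auto)
  qed
  have star_A0: "mat_star s A0 = \<epsilon> \<cdot>\<^sub>m A0"
  proof -
    have "mat_star s B = (- \<epsilon>) \<cdot>\<^sub>m (A1 * V * A1)"
      unfolding B_def using A1 car by (simp add: mat_star_mult star_V' mat_ring)
    also have "\<dots> = \<epsilon> \<cdot>\<^sub>m A0" unfolding A0 V_def[symmetric]
      by (rule eq_matI) (use A1 car in auto)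
    finally show ?thesis unfolding B_eq .
  qed
  have invA1: "invertible_mat A1" by (rule invertible_matI[OF A1 _ A1Pe]) (use car in auto)
  have "pal_poly s \<epsilon> A1 A0 0 = \<epsilon> \<cdot>\<^sub>m A1"
    unfolding pal_poly_def by (rule eq_matI) (use A1 A0 in auto)
  \<comment> \<open>Regularity is witnessed at \<open>0\<close>, where only the coefficient \<open>\<epsilon> A1\<close> remains.\<close>
  then have "det (pal_poly s \<epsilon> A1 A0 0) \<noteq> 0"
    using eps invA1 A1 invertible_mat_iff_det[OF A1] by (auto simp: det_smult)
  then show "regular_pal_system s \<epsilon> n A1 A0"
    unfolding regular_pal_system_def using A1 B B_eq star_A0 invA1 by blast
  have "?As * X * (T ^\<^sub>m 2) + A0 * X * T + \<epsilon> \<cdot>\<^sub>m (A1 * X) = R * T"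
    unfolding R_def B_eq pow_mat_two[OF T(1)] using A1 X I T B[unfolded B_eq]
    by (simp add: mat_ring)
  also have "\<dots> = 0\<^sub>m n (2 * n)" unfolding R0 using T by simp
  finally show "standard_pair s \<epsilon> n A1 A0 X T"
    unfolding standard_pair_def using X T invU unfolding U_def Y_def by blast
qed

text \<open>
  Applying the quadratic equation to an eigenvector \<open>v\<close> of \<open>T\<close> gives \<open>Q(z) X v = 0\<close>. If \<open>X v\<close> were
  zero, then so would be \<open>X T\<inverse> v = z\<inverse> X v\<close>, and \<open>v\<close> would lie in the kernel of \<open>U\<close>.
\<close>

lemma eigenpair_of_standard_pair:
  assumes pair: "standard_pair s \<epsilon> n A1 A0 X T" and A1: "A1 \<in> carrier_mat n n" and A0: "A0 \<in> carrier_mat n n"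
    and v: "v \<in> carrier_vec (2 * n)" "v \<noteq> 0\<^sub>v (2 * n)" and Tv: "T *\<^sub>v v = z \<cdot>\<^sub>v v"
  shows "is_eigenpair s \<epsilon> n A1 A0 z (X *\<^sub>v v)"
proof -
  have X: "X \<in> carrier_mat n (2 * n)" and T: "T \<in> carrier_mat (2 * n) (2 * n)" "invertible_mat T"
    and U: "invertible_mat (X @\<^sub>r (- (X * mat_inv T)))"
    and sol: "mat_star s A1 * X * (T ^\<^sub>m 2) + A0 * X * T + \<epsilon> \<cdot>\<^sub>m (A1 * X) = 0\<^sub>m n (2 * n)"
    using pair unfolding standard_pair_def by auto
  note I = mat_inv_props[OF T]
  let ?As = "mat_star s A1" and ?x = "X *\<^sub>v v"
  have As: "?As \<in> carrier_mat n n" using A1 by simp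
  have x: "?x \<in> carrier_vec n" using X v by simp
  have XT: "X *\<^sub>v (T *\<^sub>v v) = z \<cdot>\<^sub>v ?x" unfolding Tv by (rule mult_mat_vec[OF X v(1)])
  have TTv: "T *\<^sub>v (T *\<^sub>v v) = z \<cdot>\<^sub>v (z \<cdot>\<^sub>v v)" unfolding Tv by (simp add: mult_mat_vec[OF T(1) v(1)] Tv)
  have "X *\<^sub>v (T *\<^sub>v (T *\<^sub>v v)) = z\<^sup>2 \<cdot>\<^sub>v ?x"
    unfolding TTv using X v by (simp add: mult_mat_vec[OF X] power2_eq_square smult_smult_assoc)
  moreover have "(?As * X * (T * T) + A0 * X * T + \<epsilon> \<cdot>\<^sub>m (A1 * X)) *\<^sub>v v
     = ?As *\<^sub>v (X *\<^sub>v (T *\<^sub>v (T *\<^sub>v v))) + A0 *\<^sub>v (X *\<^sub>v (T *\<^sub>v v)) + \<epsilon> \<cdot>\<^sub>v (A1 *\<^sub>v ?x)"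
  proof -
    have c: "?As * X * (T * T) \<in> carrier_mat n (2*n)" "A0 * X * T \<in> carrier_mat n (2*n)"
      "\<epsilon> \<cdot>\<^sub>m (A1 * X) \<in> carrier_mat n (2*n)" "?As * X \<in> carrier_mat n (2*n)" "A0 * X \<in> carrier_mat n (2*n)"
      "T *\<^sub>v v \<in> carrier_vec (2 * n)" "T * T \<in> carrier_mat (2*n) (2*n)"
      using As A0 A1 X T v by auto
    have "(?As * X * (T * T)) *\<^sub>v v = ?As *\<^sub>v (X *\<^sub>v (T *\<^sub>v (T *\<^sub>v v)))"
      using assoc_mult_mat_vec[OF c(4) c(7) v(1)] assoc_mult_mat_vec[OF T(1) T(1) v(1)]
        assoc_mult_mat_vec[OF As X, of "T *\<^sub>v (T *\<^sub>v v)"] T c by simp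
    moreover have "(A0 * X * T) *\<^sub>v v = A0 *\<^sub>v (X *\<^sub>v (T *\<^sub>v v))"
      using assoc_mult_mat_vec[OF c(5) T(1) v(1)] assoc_mult_mat_vec[OF A0 X c(6)] by simp
    moreover have "(\<epsilon> \<cdot>\<^sub>m (A1 * X)) *\<^sub>v v = \<epsilon> \<cdot>\<^sub>v (A1 *\<^sub>v ?x)"
      using assoc_mult_mat_vec[OF A1 X v(1)] X v by (simp add: smult_mat_mult_vec)
    ultimately show ?thesis using c v add_mult_distrib_mat_vec[of _ n "2*n" _ v] by simp
  qed
  moreover have "(?As * X * (T * T) + A0 * X * T + \<epsilon> \<cdot>\<^sub>m (A1 * X)) *\<^sub>v v = 0\<^sub>v n"
    unfolding sol[unfolded pow_mat_two[OF T(1)]] using v by (intro eq_vecI) auto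
  ultimately have Q0: "0\<^sub>v n = ?As *\<^sub>v (z\<^sup>2 \<cdot>\<^sub>v ?x) + A0 *\<^sub>v (z \<cdot>\<^sub>v ?x) + \<epsilon> \<cdot>\<^sub>v (A1 *\<^sub>v ?x)"
    unfolding XT by simp
  have "pal_poly s \<epsilon> A1 A0 z *\<^sub>v ?x = 0\<^sub>v n"
    unfolding pal_poly_def Q0 using As A0 A1 x X
    by (simp add: add_mult_distrib_mat_vec[of _ n n] smult_mat_mult_vec mult_mat_vec[of _ n n])
  moreover have "?x \<noteq> 0\<^sub>v n"
  proof
    assume x0: "?x = 0\<^sub>v n"
    have Tiv: "mat_inv T *\<^sub>v v \<in> carrier_vec (2*n)" using I v by simp
    have "mat_inv T *\<^sub>v (T *\<^sub>v v) = v"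
      using assoc_mult_mat_vec[OF I(1) T(1) v(1)] I v by simp
    then have v_eq: "v = z \<cdot>\<^sub>v (mat_inv T *\<^sub>v v)"
      unfolding Tv using mult_mat_vec[OF I(1) v(1)] by simp
    have z: "z \<noteq> 0"
    proof
      assume "z = 0"
      have "v = 0 \<cdot>\<^sub>v (mat_inv T *\<^sub>v v)" using v_eq unfolding \<open>z = 0\<close> .
      also have "\<dots> = 0\<^sub>v (2 * n)" by (rule eq_vecI) (use I in auto)
      finally have "v = 0\<^sub>v (2 * n)" .
      then show False using v by simp
    qed
    have "?x = z \<cdot>\<^sub>v (X *\<^sub>v (mat_inv T *\<^sub>v v))"
      by (subst v_eq) (rule mult_mat_vec[OF X Tiv])
    then have XTi: "X *\<^sub>v (mat_inv T *\<^sub>v v) = 0\<^sub>v n"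
      using x0 z X by (auto simp: vec_eq_iff)
    let ?Y = "- (X * mat_inv T)"
    have Y: "?Y \<in> carrier_mat n (2 * n)" using X I by auto
    have "?Y *\<^sub>v v = - (X *\<^sub>v (mat_inv T *\<^sub>v v))"
      using assoc_mult_mat_vec[OF X I(1) v(1)] X I v by (intro eq_vecI) (auto simp: vec_eq_iff)
    then have Yv: "?Y *\<^sub>v v = 0\<^sub>v n" using XTi by auto
    have Uc: "X @\<^sub>r ?Y \<in> carrier_mat (2*n) (2*n)" using X Y by (auto simp: mult_2)
    note J = mat_inv_props[OF Uc U]
    have "(X @\<^sub>r ?Y) *\<^sub>v v = 0\<^sub>v (2 * n)"
      unfolding mat_mult_append[OF X Y v(1)] x0 Yv by (auto simp: mult_2)
    then have "mat_inv (X @\<^sub>r ?Y) *\<^sub>v ((X @\<^sub>r ?Y) *\<^sub>v v) = 0\<^sub>v (2*n)"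
      using J(1) by (auto intro!: eq_vecI)
    then have "v = 0\<^sub>v (2*n)" using assoc_mult_mat_vec[OF J(1) Uc v(1)] J v by simp
    then show False using v by simp
  qed
  ultimately show ?thesis unfolding is_eigenpair_def using x by blast
qed

section \<open>Splitting the spectral data\<close>

lemma pairing_block_form:
  assumes A1: "A1 \<in> carrier_mat n n" and X1: "X1 \<in> carrier_mat n a" and X2: "X2 \<in> carrier_mat n b"
    and T1: "T1 \<in> carrier_mat a a" "invertible_mat T1" and T2: "T2 \<in> carrier_mat b b" "invertible_mat T2"
  shows "pairing s \<epsilon> A1 (append_cols X1 X2) (diag_block_mat [T1, T2]) =
    four_block_mat (pairing s \<epsilon> A1 X1 T1)
      (\<epsilon> \<cdot>\<^sub>m (mat_star s X1 * A1 * X2 * mat_inv T2)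
        - mat_star s (mat_inv T1) * mat_star s X1 * mat_star s A1 * X2)
      (\<epsilon> \<cdot>\<^sub>m (mat_star s X2 * A1 * X1 * mat_inv T1)
        - mat_star s (mat_inv T2) * mat_star s X2 * mat_star s A1 * X1)
      (pairing s \<epsilon> A1 X2 T2)"
proof -
  note I1 = mat_inv_props[OF T1] and I2 = mat_inv_props[OF T2]
  let ?X = "append_cols X1 X2" and ?T = "diag_block_mat [T1, T2]"
  let ?Y1 = "X1 * mat_inv T1" and ?Y2 = "X2 * mat_inv T2"
  let ?Y = "append_cols ?Y1 ?Y2" and ?Xs1 = "mat_star s X1" and ?Xs2 = "mat_star s X2" and ?As = "mat_star s A1"
  have X: "?X \<in> carrier_mat n (a + b)" using X1 X2 by auto
  have T: "?T \<in> carrier_mat (a + b) (a + b)" "invertible_mat ?T"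
    using diag_pair_carrier[OF T1(1) T2(1)] diag_pair_inverse(1)[OF T1(1) T2(1)] T1 T2 by auto
  note I = mat_inv_props[OF T]
  have Y_eq: "?X * mat_inv ?T = ?Y"
    using diag_pair_inverse(2)[OF T1(1) T2(1) T1(2) T2(2)] append_cols_mult_diag_pair[OF X1 X2 I1(1) I2(1)] by simp
  have Y: "?Y1 \<in> carrier_mat n a" "?Y2 \<in> carrier_mat n b" using X1 X2 I1 I2 by auto
  have pairing: "pairing s \<epsilon> A1 ?X ?T = \<epsilon> \<cdot>\<^sub>m (mat_star s ?X * A1 * ?Y) - mat_star s ?Y * ?As * ?X"
    unfolding pairing_def Y_eq[symmetric] using X1 X2 A1 I by (simp add: mat_assoc mat_star_mult)
  have P: "mat_star s ?X * A1 * ?Y =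
    four_block_mat (?Xs1 * A1 * ?Y1) (?Xs1 * A1 * ?Y2) (?Xs2 * A1 * ?Y1) (?Xs2 * A1 * ?Y2)"
  proof -
    have c: "?Xs1 \<in> carrier_mat a n" "?Xs2 \<in> carrier_mat b n" "?Xs1 * A1 \<in> carrier_mat a n" "?Xs2 * A1 \<in> carrier_mat b n"
      using X1 X2 A1 by auto
    have "mat_star s ?X = ?Xs1 @\<^sub>r ?Xs2" using X1 X2 by (intro mat_star_append_cols) auto
    then show ?thesis
      using append_rows_mult[OF c(1,2) A1] append_rows_mult_append_cols[OF c(3,4) Y] by simp
  qed
  have M: "mat_star s ?Y * ?As * ?X = four_block_mat (mat_star s ?Y1 * ?As * X1) (mat_star s ?Y1 * ?As * X2)
      (mat_star s ?Y2 * ?As * X1) (mat_star s ?Y2 * ?As * X2)"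
  proof -
    have c: "mat_star s ?Y1 \<in> carrier_mat a n" "mat_star s ?Y2 \<in> carrier_mat b n" "?As \<in> carrier_mat n n"
      "mat_star s ?Y1 * ?As \<in> carrier_mat a n" "mat_star s ?Y2 * ?As \<in> carrier_mat b n"
      using X1 X2 I1 I2 A1 by auto
    have "mat_star s ?Y = mat_star s ?Y1 @\<^sub>r mat_star s ?Y2" using X1 X2 by (intro mat_star_append_cols) auto
    then show ?thesis
      using append_rows_mult[OF c(1,2,3)] append_rows_mult_append_cols[OF c(4,5) X1 X2] by simp
  qed
  have "pairing s \<epsilon> A1 ?X ?T =
    four_block_mat (\<epsilon> \<cdot>\<^sub>m (?Xs1 * A1 * ?Y1) - mat_star s ?Y1 * ?As * X1)
       (\<epsilon> \<cdot>\<^sub>m (?Xs1 * A1 * ?Y2) - mat_star s ?Y1 * ?As * X2)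
       (\<epsilon> \<cdot>\<^sub>m (?Xs2 * A1 * ?Y1) - mat_star s ?Y2 * ?As * X1)
       (\<epsilon> \<cdot>\<^sub>m (?Xs2 * A1 * ?Y2) - mat_star s ?Y2 * ?As * X2)"
    unfolding pairing P M
    by (rule smult_minus_four_block[of _ a a _ b _ b]) (use X1 X2 A1 I1 I2 in auto)
  then show ?thesis
    unfolding pairing_def using X1 X2 A1 I1 I2 by (simp add: mat_assoc mat_star_mult)
qed

text \<open>
  The off-diagonal block \<open>W12\<close> of the invariant matrix satisfies \<open>T1\<^sup>\<star> W12 T2 = W12\<close>, a Sylvester
  equation with disjoint spectra, so it vanishes. The other one vanishes because \<open>W\<^sup>\<star> = - \<epsilon> W\<close>.
\<close>

lemma pairing_block_diagonal:
  assumes eps: "\<epsilon> \<in> {1, -1}"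
    and A1: "A1 \<in> carrier_mat n n" and X1: "X1 \<in> carrier_mat n a" and X2: "X2 \<in> carrier_mat n b"
    and T1: "T1 \<in> carrier_mat a a" "invertible_mat T1" and T2: "T2 \<in> carrier_mat b b" "invertible_mat T2"
    and inv: "mat_star s (diag_block_mat [T1, T2]) * pairing s \<epsilon> A1 (append_cols X1 X2) (diag_block_mat [T1, T2])
        * diag_block_mat [T1, T2] = pairing s \<epsilon> A1 (append_cols X1 X2) (diag_block_mat [T1, T2])"
    and disj: "spectrum (mat_star s (mat_inv T1)) \<inter> spectrum T2 = {}"
  shows "pairing s \<epsilon> A1 (append_cols X1 X2) (diag_block_mat [T1, T2])
    = diag_block_mat [pairing s \<epsilon> A1 X1 T1, pairing s \<epsilon> A1 X2 T2]"
proof -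
  note I1 = mat_inv_props[OF T1] and I2 = mat_inv_props[OF T2]
  let ?T = "diag_block_mat [T1, T2]"
  let ?W = "pairing s \<epsilon> A1 (append_cols X1 X2) ?T"
  define W11 W12 W21 W22 where
    "W11 = pairing s \<epsilon> A1 X1 T1" and
    "W12 = \<epsilon> \<cdot>\<^sub>m (mat_star s X1 * A1 * X2 * mat_inv T2)
        - mat_star s (mat_inv T1) * mat_star s X1 * mat_star s A1 * X2" and
    "W21 = \<epsilon> \<cdot>\<^sub>m (mat_star s X2 * A1 * X1 * mat_inv T1)
        - mat_star s (mat_inv T2) * mat_star s X2 * mat_star s A1 * X1" and
    "W22 = pairing s \<epsilon> A1 X2 T2"
  have W: "?W = four_block_mat W11 W12 W21 W22"
    unfolding W11_def W12_def W21_def W22_def by (rule pairing_block_form[OF A1 X1 X2 T1 T2])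
  have c: "W11 \<in> carrier_mat a a" "W12 \<in> carrier_mat a b" "W21 \<in> carrier_mat b a" "W22 \<in> carrier_mat b b"
    unfolding W11_def W12_def W21_def W22_def pairing_def using A1 X1 X2 I1 I2 by auto
  have Tc: "?T \<in> carrier_mat (a + b) (a + b)" "invertible_mat ?T"
    using diag_pair_carrier[OF T1(1) T2(1)] diag_pair_inverse(1)[OF T1(1) T2(1)] T1 T2 by auto
  have Ts: "mat_star s T1 \<in> carrier_mat a a" "mat_star s T2 \<in> carrier_mat b b" using T1 T2 by auto
  have blocks: "four_block_mat (mat_star s T1 * W11 * T1) (mat_star s T1 * W12 * T2)
     (mat_star s T2 * W21 * T1) (mat_star s T2 * W22 * T2) = four_block_mat W11 W12 W21 W22"
  proof -
    have "mat_star s ?T * four_block_mat W11 W12 W21 W22 = four_block_mat (mat_star s T1 * W11)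
       (mat_star s T1 * W12) (mat_star s T2 * W21) (mat_star s T2 * W22)"
      unfolding mat_star_diag_pair[OF T1(1) T2(1)] unfolding diag_block_mat_pair using c Ts
      by (subst mult_four_block_mat[of _ a a _ b _ b _ _ a _ b]) (use T1 T2 in auto)
    then have "mat_star s ?T * ?W * ?T = four_block_mat (mat_star s T1 * W11)
       (mat_star s T1 * W12) (mat_star s T2 * W21) (mat_star s T2 * W22) * ?T" unfolding W by simp
    also have "\<dots> = four_block_mat (mat_star s T1 * W11 * T1) (mat_star s T1 * W12 * T2)
     (mat_star s T2 * W21 * T1) (mat_star s T2 * W22 * T2)"
      unfolding diag_block_mat_pair using c T1 T2
      by (subst mult_four_block_mat[of _ a a _ b _ b _ _ a _ b]) auto
    finally have *: "mat_star s ?T * ?W * ?T = four_block_mat (mat_star s T1 * W11 * T1)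
      (mat_star s T1 * W12 * T2) (mat_star s T2 * W21 * T1) (mat_star s T2 * W22 * T2)" .
    show ?thesis using trans[OF *[symmetric] trans[OF inv W]] .
  qed
  have W12: "mat_star s T1 * W12 * T2 = W12"
    by (rule four_block_mat_inject(2)[OF blocks, of a a b b]) (use c T1 T2 in auto)
  have TT: "mat_star s (mat_inv T1) * mat_star s T1 = 1\<^sub>m a"
    using I1 T1 by (simp flip: mat_star_mult)
  have "mat_star s (mat_inv T1) * W12 = mat_star s (mat_inv T1) * (mat_star s T1 * W12 * T2)"
    unfolding W12 ..
  also have "\<dots> = W12 * T2"
    using I1 T1 T2 c by (simp add: mat_assoc mat_cancel_left[OF TT])
  finally have W12_0: "W12 = 0\<^sub>m a b"
    by (intro sylvester_unique[OF _ T2(1) c(2) _ disj]) (use I1 in auto)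
  have "mat_star s ?W = (- \<epsilon>) \<cdot>\<^sub>m ?W"
    by (rule mat_star_pairing[OF eps A1 _ Tc]) (use X1 X2 in auto)
  then have "four_block_mat (mat_star s W11) (mat_star s W21) (mat_star s W12) (mat_star s W22)
    = four_block_mat ((- \<epsilon>) \<cdot>\<^sub>m W11) ((- \<epsilon>) \<cdot>\<^sub>m W12) ((- \<epsilon>) \<cdot>\<^sub>m W21) ((- \<epsilon>) \<cdot>\<^sub>m W22)"
    unfolding W mat_star_four_block[OF c] using c by (auto intro!: eq_matI)
  then have "mat_star s W21 = (- \<epsilon>) \<cdot>\<^sub>m W12"
    by (rule four_block_mat_inject(2)[of _ _ _ _ _ _ _ _ a a b b]) (use c in auto)
  also have "\<dots> = 0\<^sub>m a b" unfolding W12_0 by (auto intro!: eq_matI)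
  finally have "mat_star s (mat_star s W21) = 0\<^sub>m b a" by simp
  then have W21_0: "W21 = 0\<^sub>m b a" by simp
  show ?thesis unfolding W unfolding diag_block_mat_pair W12_0 W21_0 W11_def[symmetric] W22_def[symmetric]
    using c by simp
qed

text \<open>
  For block-diagonal \<open>T\<close> and \<open>S\<close> the conditions decouple: the symmetries of \<open>S\<close> hold block by
  block, and the expressions built from \<open>X\<close> become sums of the contributions of both parts. This is
  what allows one part to be exchanged without touching the other.
\<close>

lemma spectral_triple_append_cols:
  assumes X1: "X1 \<in> carrier_mat n a" and X2: "X2 \<in> carrier_mat n b"
    and T1: "T1 \<in> carrier_mat a a" "invertible_mat T1" and T2: "T2 \<in> carrier_mat b b" "invertible_mat T2"
    and S1: "S1 \<in> carrier_mat a a" and S2: "S2 \<in> carrier_mat b b"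
    and ab: "a + b = 2 * n"
  shows "spectral_triple s \<epsilon> n A1 (append_cols X1 X2) (diag_block_mat [T1, T2]) (diag_block_mat [S1, S2]) \<longleftrightarrow>
    S1 \<in> S_set s \<epsilon> a T1 \<and> S2 \<in> S_set s \<epsilon> b T2 \<and>
    X1 * S1 * mat_star s X1 + X2 * S2 * mat_star s X2 = 0\<^sub>m n n \<and>
    A1 * (X1 * mat_inv T1 * S1 * mat_star s X1 + X2 * mat_inv T2 * S2 * mat_star s X2) = \<epsilon> \<cdot>\<^sub>m 1\<^sub>m n"
  and "append_cols X1 X2 * mat_inv (diag_block_mat [T1, T2]) * mat_inv (diag_block_mat [T1, T2])
      * diag_block_mat [S1, S2] * mat_star s (append_cols X1 X2) =
    X1 * mat_inv T1 * mat_inv T1 * S1 * mat_star s X1 + X2 * mat_inv T2 * mat_inv T2 * S2 * mat_star s X2"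
proof -
  note I1 = mat_inv_props[OF T1] and I2 = mat_inv_props[OF T2]
  let ?X = "append_cols X1 X2" and ?T = "diag_block_mat [T1, T2]" and ?S = "diag_block_mat [S1, S2]"
  have Ti: "mat_inv ?T = diag_block_mat [mat_inv T1, mat_inv T2]"
    by (rule diag_pair_inverse(2)[OF T1(1) T2(1) T1(2) T2(2)])
  have gram: "append_cols Y1 Y2 * ?S * mat_star s ?X = Y1 * S1 * mat_star s X1 + Y2 * S2 * mat_star s X2"
    if "Y1 \<in> carrier_mat n a" "Y2 \<in> carrier_mat n b" for Y1 Y2
    using append_cols_mult_diag_pair[OF that S1 S2]
      append_cols_mult_star[of "Y1 * S1" n a "Y2 * S2" b X1 X2 s] that S1 S2 X1 X2 by simp
  have XTi: "?X * mat_inv ?T = append_cols (X1 * mat_inv T1) (X2 * mat_inv T2)"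
    unfolding Ti by (rule append_cols_mult_diag_pair[OF X1 X2 I1(1) I2(1)])
  have XTiTi: "?X * mat_inv ?T * mat_inv ?T = append_cols (X1 * mat_inv T1 * mat_inv T1) (X2 * mat_inv T2 * mat_inv T2)"
    unfolding XTi unfolding Ti by (rule append_cols_mult_diag_pair) (use X1 X2 I1 I2 in auto)
  show "?X * mat_inv ?T * mat_inv ?T * ?S * mat_star s ?X =
    X1 * mat_inv T1 * mat_inv T1 * S1 * mat_star s X1 + X2 * mat_inv T2 * mat_inv T2 * S2 * mat_star s X2"
    unfolding XTiTi by (rule gram) (use X1 X2 I1 I2 in auto)
  have Tc: "?T \<in> carrier_mat (2 * n) (2 * n)" "invertible_mat ?T" and Sc: "?S \<in> carrier_mat (2 * n) (2 * n)"
    using diag_pair_carrier[OF T1(1) T2(1)] diag_pair_inverse(1)[OF T1(1) T2(1)] T1 T2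
      diag_pair_carrier[OF S1 S2] ab by auto
  have Xc: "?X \<in> carrier_mat n (2 * n)" using X1 X2 ab by auto
  have 1: "mat_star s ?S = (- \<epsilon>) \<cdot>\<^sub>m ?S \<longleftrightarrow> mat_star s S1 = (- \<epsilon>) \<cdot>\<^sub>m S1 \<and> mat_star s S2 = (- \<epsilon>) \<cdot>\<^sub>m S2"
    unfolding mat_star_diag_pair[OF S1 S2] smult_diag_pair[OF S1 S2]
    using diag_pair_inject[of "mat_star s S1" "mat_star s S2" "(- \<epsilon>) \<cdot>\<^sub>m S1" "(- \<epsilon>) \<cdot>\<^sub>m S2" a b] S1 S2 by auto
  have "?T * ?S * mat_star s ?T = diag_block_mat [T1 * S1 * mat_star s T1, T2 * S2 * mat_star s T2]"
    unfolding mat_star_diag_pair[OF T1(1) T2(1)] diag_pair_mult[OF T1(1) T2(1) S1 S2]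
    by (rule diag_pair_mult) (use T1 T2 S1 S2 in auto)
  moreover have "T1 * S1 * mat_star s T1 \<in> carrier_mat a a" "T2 * S2 * mat_star s T2 \<in> carrier_mat b b"
    using T1 T2 S1 S2 by auto
  ultimately have 2: "?S = ?T * ?S * mat_star s ?T \<longleftrightarrow> S1 = T1 * S1 * mat_star s T1 \<and> S2 = T2 * S2 * mat_star s T2"
    using diag_pair_inject[OF _ S1 S2] by metis
  have 3: "?X * ?S * mat_star s ?X = X1 * S1 * mat_star s X1 + X2 * S2 * mat_star s X2"
    by (rule gram[OF X1 X2])
  have 4: "?X * mat_inv ?T * ?S * mat_star s ?X
      = X1 * mat_inv T1 * S1 * mat_star s X1 + X2 * mat_inv T2 * S2 * mat_star s X2"
    unfolding XTi by (rule gram) (use X1 X2 I1 I2 in auto)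
  show "spectral_triple s \<epsilon> n A1 ?X ?T ?S \<longleftrightarrow>
    S1 \<in> S_set s \<epsilon> a T1 \<and> S2 \<in> S_set s \<epsilon> b T2 \<and>
    X1 * S1 * mat_star s X1 + X2 * S2 * mat_star s X2 = 0\<^sub>m n n \<and>
    A1 * (X1 * mat_inv T1 * S1 * mat_star s X1 + X2 * mat_inv T2 * S2 * mat_star s X2) = \<epsilon> \<cdot>\<^sub>m 1\<^sub>m n"
    unfolding spectral_triple_def S_set_def 1 3 4 using 2 Tc Sc Xc S1 S2 by auto
qed

section \<open>The update\<close>

text \<open>
  The Sherman-Morrison-Woodbury formula for \<open>G = \<epsilon> A\<inverse>\<close>. Put \<open>P = A Z1 \<Xi>\<inverse> Z2s\<close>. Expanding the
  product leaves \<open>\<epsilon> - P + A Z1 Z2s - \<epsilon> P A Z1 Z2s\<close>, and the last three terms cancel because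
  \<open>\<epsilon> P A Z1 Z2s + P = A Z1 \<Xi>\<inverse> (\<epsilon> Z2s A Z1 + 1) Z2s = A Z1 Z2s\<close>.
\<close>

lemma woodbury_rank_update:
  assumes eps: "\<epsilon> \<in> {1, -1}"
    and A: "A \<in> carrier_mat n n" and G: "G \<in> carrier_mat n n" and AG: "A * G = \<epsilon> \<cdot>\<^sub>m 1\<^sub>m n"
    and Z1: "Z1 \<in> carrier_mat n l" and Z2: "Z2s \<in> carrier_mat l n"
    and Xi: "\<Xi> = 1\<^sub>m l + \<epsilon> \<cdot>\<^sub>m (Z2s * A * Z1)" "invertible_mat \<Xi>"
  shows "(A - \<epsilon> \<cdot>\<^sub>m (A * Z1 * mat_inv \<Xi> * Z2s * A)) * (G + Z1 * Z2s) = \<epsilon> \<cdot>\<^sub>m 1\<^sub>m n"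
proof -
  have Xc: "\<Xi> \<in> carrier_mat l l" using Xi(1) A Z1 Z2 by auto
  note I = mat_inv_props[OF Xc Xi(2)]
  note ee = eps_square[OF eps]
  let ?Xii = "mat_inv \<Xi>"
  define P where "P = A * Z1 * ?Xii * Z2s"
  define M where "M = A * Z1 * Z2s"
  have c: "P \<in> carrier_mat n n" "M \<in> carrier_mat n n" unfolding P_def M_def using A Z1 Z2 I by auto
  have 1: "(\<epsilon> \<cdot>\<^sub>m (P * A)) * G = P"
  proof -
    have "(\<epsilon> \<cdot>\<^sub>m (P * A)) * G = \<epsilon> \<cdot>\<^sub>m (P * (A * G))" using A G c by (simp add: mat_ring)
    also have "\<dots> = P" unfolding AG using c by (simp add: mat_mult_smult mat_smult_smult ee mat_one_smult)
    finally show ?thesis .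
  qed
  have 2: "(\<epsilon> \<cdot>\<^sub>m (P * A)) * (Z1 * Z2s) + P = M"
  proof -
    have "(\<epsilon> \<cdot>\<^sub>m (P * A)) * (Z1 * Z2s) + P = A * Z1 * ?Xii * (\<epsilon> \<cdot>\<^sub>m (Z2s * A * Z1) + 1\<^sub>m l) * Z2s"
      unfolding P_def using A Z1 Z2 I by (simp add: mat_ring)
    also have "\<epsilon> \<cdot>\<^sub>m (Z2s * A * Z1) + 1\<^sub>m l = \<Xi>"
      unfolding Xi(1) by (rule comm_add_mat) (use A Z1 Z2 in auto)
    also have "A * Z1 * ?Xii * \<Xi> * Z2s = M"
      unfolding M_def using A Z1 Z2 I Xc by (simp add: mat_assoc mat_cancel_left[OF I(3)])
    finally show ?thesis .
  qed
  have "(A - \<epsilon> \<cdot>\<^sub>m (P * A)) * (G + Z1 * Z2s)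
     = (\<epsilon> \<cdot>\<^sub>m 1\<^sub>m n - P) + (M - (\<epsilon> \<cdot>\<^sub>m (P * A)) * (Z1 * Z2s))"
  proof -
    have "(A - \<epsilon> \<cdot>\<^sub>m (P * A)) * (G + Z1 * Z2s) = (A - \<epsilon> \<cdot>\<^sub>m (P * A)) * G + (A - \<epsilon> \<cdot>\<^sub>m (P * A)) * (Z1 * Z2s)"
      by (rule mat_mult_add) (use A G c Z1 Z2 in auto)
    also have "(A - \<epsilon> \<cdot>\<^sub>m (P * A)) * G = A * G - (\<epsilon> \<cdot>\<^sub>m (P * A)) * G"
      by (rule mat_minus_mult) (use A G c in auto)
    also have "\<dots> = \<epsilon> \<cdot>\<^sub>m 1\<^sub>m n - P" unfolding 1 AG ..
    also have "(A - \<epsilon> \<cdot>\<^sub>m (P * A)) * (Z1 * Z2s) = A * (Z1 * Z2s) - (\<epsilon> \<cdot>\<^sub>m (P * A)) * (Z1 * Z2s)"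
      by (rule mat_minus_mult) (use A c Z1 Z2 in auto)
    also have "A * (Z1 * Z2s) = M" unfolding M_def using A Z1 Z2 by (simp add: mat_assoc)
    finally show ?thesis .
  qed
  also have "\<dots> = \<epsilon> \<cdot>\<^sub>m 1\<^sub>m n"
    unfolding 2[symmetric] by (rule eq_matI) (use c A Z1 Z2 in \<open>auto simp del: index_mult_mat(1)\<close>)
  finally show ?thesis unfolding P_def .
qed

theorem theorem4p1:
  fixes s :: star_op and \<epsilon> :: complex and n k l :: nat
    and A1 A0 X1 T1 X2 T2 S1 T1' S1' X1' Z1 Z2 \<Xi> \<Upsilon> A1' A0' :: "complex mat"
    and mu :: "nat \<Rightarrow> complex"
  assumes eps: "\<epsilon> \<in> {1, -1}"
    and Q: "regular_pal_system s \<epsilon> n A1 A0"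
    and k: "k \<le> 2 * n"
    and X1: "X1 \<in> carrier_mat n k" and T1: "T1 \<in> carrier_mat k k"
    and X2: "X2 \<in> carrier_mat n (2 * n - k)" and T2: "T2 \<in> carrier_mat (2 * n - k) (2 * n - k)"
    and pair: "standard_pair s \<epsilon> n A1 A0 (append_cols X1 X2) (diag_block_mat [T1, T2])"
    and T1': "T1' = mat_diag k mu"
    and sim: "similar_mat T1 (mat_star s (mat_inv T1))"
    and disjoint: "spectrum T1 \<inter> spectrum T2 = {}"
    and S1: "S1 = mat_inv (\<epsilon> \<cdot>\<^sub>m (mat_star s X1 * A1 * X1 * mat_inv T1)
                     - mat_star s (mat_inv T1) * mat_star s X1 * mat_star s A1 * X1)"
    and S1': "S1' \<in> S_set s \<epsilon> k T1'" "invertible_mat S1'"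
    and X1': "X1' \<in> carrier_mat n k"
    and X1'_eq: "X1' * S1' * mat_star s X1' = X1 * S1 * mat_star s X1"
    and Z: "rank_factorization s n l
              (X1' * mat_inv T1' * S1' * mat_star s X1' - X1 * mat_inv T1 * S1 * mat_star s X1) Z1 Z2"
    and Xi: "\<Xi> = 1\<^sub>m l + \<epsilon> \<cdot>\<^sub>m (mat_star s Z2 * A1 * Z1)" "invertible_mat \<Xi>"
    and Upsilon: "\<Upsilon> = X1' * (mat_inv T1' ^\<^sub>m 2) * S1' * mat_star s X1'
                       - X1 * (mat_inv T1 ^\<^sub>m 2) * S1 * mat_star s X1"
    and A1': "A1' = A1 - \<epsilon> \<cdot>\<^sub>m (A1 * Z1 * mat_inv \<Xi> * mat_star s Z2 * A1)"
    and A0': "A0' = (1\<^sub>m n - \<epsilon> \<cdot>\<^sub>m (A1 * Z1 * mat_inv \<Xi> * mat_star s Z2))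
                    * (A0 - A1 * \<Upsilon> * A1)
                    * (1\<^sub>m n - \<epsilon> \<cdot>\<^sub>m (Z1 * mat_inv \<Xi> * mat_star s Z2 * A1))"
  shows "solves_MUP_QP s \<epsilon> n k X2 T2 mu X1' A1' A0'"
proof -
  define m where "m = 2 * n - k"
  note X2 = X2[folded m_def] and T2 = T2[folded m_def]
  have km: "k + m = 2 * n" using k unfolding m_def by simp
  have A1: "A1 \<in> carrier_mat n n" using Q unfolding regular_pal_system_def by auto
  let ?T = "diag_block_mat [T1, T2]" and ?X = "append_cols X1 X2"
  have "invertible_mat ?T" using pair unfolding standard_pair_def by auto
  then have iT1: "invertible_mat T1" and iT2: "invertible_mat T2"
    using diag_pair_inverse(1)[OF T1 T2] by auto
  note I1 = mat_inv_props[OF T1 iT1] and I2 = mat_inv_props[OF T2 iT2]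

  define W1 where "W1 = pairing s \<epsilon> A1 X1 T1"
  define W2 where "W2 = pairing s \<epsilon> A1 X2 T2"
  define S2 where "S2 = mat_inv W2"
  have S1_eq: "S1 = mat_inv W1" unfolding S1 W1_def pairing_def ..
  have W12: "W1 \<in> carrier_mat k k" "W2 \<in> carrier_mat m m"
    unfolding W1_def W2_def pairing_def using X1 X2 A1 I1 I2 by auto
  note old = spectral_triple_of_standard_pair[OF eps Q pair]
  have W: "pairing s \<epsilon> A1 ?X ?T = diag_block_mat [W1, W2]"
    unfolding W1_def W2_def
  proof (rule pairing_block_diagonal[OF eps A1 X1 X2 T1 iT1 T2 iT2 old(4)])
    show "spectrum (mat_star s (mat_inv T1)) \<inter> spectrum T2 = {}"
      using spectrum_similar[OF sim] disjoint by simp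
  qed
  have inv: "invertible_mat W1" "invertible_mat W2"
    using old(1) diag_pair_inverse(1)[OF W12] unfolding W by auto
  have S: "mat_inv (diag_block_mat [W1, W2]) = diag_block_mat [S1, S2]"
    unfolding S1_eq S2_def by (rule diag_pair_inverse(2)[OF W12 inv])
  have S12: "S1 \<in> carrier_mat k k" "S2 \<in> carrier_mat m m"
    using mat_inv_props[OF W12(1) inv(1)] mat_inv_props[OF W12(2) inv(2)] unfolding S1_eq S2_def by auto

  \<comment> \<open>\<open>G\<close> and \<open>V\<close> are \<open>X T\<inverse> S X\<^sup>\<star>\<close> and \<open>X T\<^sup>-\<^sup>2 S X\<^sup>\<star>\<close> for the original system, split into
    both parts; the primed versions below belong to the new one.\<close>
  define G where "G = X1 * mat_inv T1 * S1 * mat_star s X1 + X2 * mat_inv T2 * S2 * mat_star s X2"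
  define V where "V = X1 * mat_inv T1 * mat_inv T1 * S1 * mat_star s X1
      + X2 * mat_inv T2 * mat_inv T2 * S2 * mat_star s X2"
  note blocks = spectral_triple_append_cols[OF X1 X2 T1 iT1 T2 iT2 S12 km]
  have S2: "S2 \<in> S_set s \<epsilon> m T2"
    and XSX: "X1 * S1 * mat_star s X1 + X2 * S2 * mat_star s X2 = 0\<^sub>m n n"
    and AG: "A1 * G = \<epsilon> \<cdot>\<^sub>m 1\<^sub>m n"
    using old(2)[unfolded W S blocks(1)] unfolding G_def by auto
  have A0: "A0 = - (A1 * V * A1)"
    using old(3)[unfolded W S blocks(2)] unfolding V_def .
  have GV: "G \<in> carrier_mat n n" "V \<in> carrier_mat n n"
    unfolding G_def V_def using X1 X2 I1 I2 S12 by auto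

  have T1'c: "T1' \<in> carrier_mat k k" unfolding T1' by simp
  have S1'c: "S1' \<in> carrier_mat k k" and S1'_eq: "S1' = T1' * S1' * mat_star s T1'"
    using S1' unfolding S_set_def by auto
  \<comment> \<open>\<open>S1' = T1' S1' T1'\<^sup>\<star>\<close> with \<open>S1'\<close> nonsingular excludes zero among the new eigenvalues.\<close>
  have iT1': "invertible_mat T1'"
  proof -
    have "det S1' = det (T1' * (S1' * mat_star s T1'))"
      using S1'_eq T1'c S1'c by (simp add: mat_assoc)
    also have "\<dots> = det T1' * det (S1' * mat_star s T1')"
      by (rule det_mult[OF T1'c]) (use T1'c S1'c in auto)
    finally show ?thesis
      using invertible_mat_iff_det[OF S1'c] invertible_mat_iff_det[OF T1'c] S1' by auto
  qed
  note I1' = mat_inv_props[OF T1'c iT1']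

  have Z1: "Z1 \<in> carrier_mat n l" and Z2: "Z2 \<in> carrier_mat n l"
    and ZZ: "X1' * mat_inv T1' * S1' * mat_star s X1' - X1 * mat_inv T1 * S1 * mat_star s X1 = Z1 * mat_star s Z2"
    using Z unfolding rank_factorization_def by auto
  define Z2s where "Z2s = mat_star s Z2"
  have Z2s: "Z2s \<in> carrier_mat l n" using Z2 unfolding Z2s_def by simp
  have Xic: "\<Xi> \<in> carrier_mat l l" unfolding Xi(1) using A1 Z1 Z2 by auto
  note IX = mat_inv_props[OF Xic Xi(2)]
  \<comment> \<open>Factoring \<open>A1' = L A1 = A1 R\<close> absorbs the outer factors of \<open>A0'\<close> into \<open>A1'\<close>.\<close>
  define L where "L = 1\<^sub>m n - \<epsilon> \<cdot>\<^sub>m (A1 * Z1 * mat_inv \<Xi> * Z2s)"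
  define R where "R = 1\<^sub>m n - \<epsilon> \<cdot>\<^sub>m (Z1 * mat_inv \<Xi> * Z2s * A1)"
  have LR: "L \<in> carrier_mat n n" "R \<in> carrier_mat n n" unfolding L_def R_def using A1 Z1 Z2s IX by auto
  have A1'L: "A1' = L * A1" unfolding A1' L_def Z2s_def[symmetric]
    using A1 Z1 Z2s IX by (simp add: mat_ring)
  have A1'R: "A1' = A1 * R" unfolding A1' R_def Z2s_def[symmetric]
    using A1 Z1 Z2s IX by (simp add: mat_ring)
  have A1'c: "A1' \<in> carrier_mat n n" unfolding A1'L using LR A1 by auto

  define G' where "G' = X1' * mat_inv T1' * S1' * mat_star s X1' + X2 * mat_inv T2 * S2 * mat_star s X2"
  define V' where "V' = X1' * mat_inv T1' * mat_inv T1' * S1' * mat_star s X1'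
      + X2 * mat_inv T2 * mat_inv T2 * S2 * mat_star s X2"
  have G': "G' = G + Z1 * Z2s"
    unfolding G'_def G_def Z2s_def ZZ[symmetric]
    by (rule eq_matI) (use X1 X2 X1' I1 I2 I1' S12 S1'c in \<open>auto simp del: index_mult_mat(1)\<close>)
  have V': "V' = V + \<Upsilon>"
    unfolding V'_def V_def Upsilon pow_mat_two[OF I1(1)] pow_mat_two[OF I1'(1)]
    by (rule eq_matI)
      (use X1 X2 X1' I1 I2 I1' S12 S1'c in \<open>auto simp: mat_assoc simp del: index_mult_mat(1)\<close>)
  have Uc: "\<Upsilon> \<in> carrier_mat n n" unfolding Upsilon using X1 X1' I1 I1' S12 S1'c by auto

  let ?T' = "diag_block_mat [T1', T2]" and ?X' = "append_cols X1' X2"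
  note blocks' = spectral_triple_append_cols[OF X1' X2 T1'c iT1' T2 iT2 S1'c S12(2) km]
  have "A1' * G' = \<epsilon> \<cdot>\<^sub>m 1\<^sub>m n"
    unfolding A1' G' Z2s_def[symmetric]
    by (rule woodbury_rank_update[OF eps A1 GV(1) AG Z1 Z2s Xi(1)[folded Z2s_def] Xi(2)])
  then have triple': "spectral_triple s \<epsilon> n A1' ?X' ?T' (diag_block_mat [S1', S2])"
    unfolding blocks'(1) G'_def using S1'(1) S2 XSX X1'_eq by simp
  have "A0' = L * (- (A1 * V * A1) - A1 * \<Upsilon> * A1) * R"
    unfolding A0' A0 L_def R_def Z2s_def ..
  also have "- (A1 * V * A1) - A1 * \<Upsilon> * A1 = - (A1 * V' * A1)"
  proof -
    have "A1 * V' * A1 = A1 * V * A1 + A1 * \<Upsilon> * A1" unfolding V' using A1 GV Uc by (simp add: mat_ring)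
    then show ?thesis
      by (intro eq_matI) (use A1 GV Uc in \<open>auto simp del: index_mult_mat(1)\<close>)
  qed
  also have "L * (- (A1 * V' * A1)) * R = - ((L * A1) * V' * (A1 * R))"
    unfolding V' using A1 LR GV Uc by (simp add: mat_ring)
  finally have "A0' = - (A1' * V' * A1')" unfolding A1'L[symmetric] A1'R[symmetric] .
  then have A0'_eq: "A0' = - (A1' * (?X' * mat_inv ?T' * mat_inv ?T' * diag_block_mat [S1', S2] * mat_star s ?X') * A1')"
    unfolding V'_def blocks'(2) .
  note new = system_of_spectral_triple[OF eps A1'c triple' A0'_eq]

  have eig: "is_eigenpair s \<epsilon> n A1' A0' (mu j) (col X1' j)" if j: "j < k" for j
  proof -
    have j2: "j < 2 * n" using j k by simp
    have T'c: "?T' \<in> carrier_mat (2 * n) (2 * n)" using diag_pair_carrier[OF T1'c T2] km by simp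
    have X'c: "?X' \<in> carrier_mat n (2 * n)" using X1' X2 km by auto
    have "?T' *\<^sub>v unit_vec (2 * n) j = mu j \<cdot>\<^sub>v unit_vec (2 * n) j"
    proof -
      have "?T' *\<^sub>v unit_vec (2 * n) j = col ?T' j"
        using T'c j2 by (intro eq_vecI) auto
      also have "\<dots> = mu j \<cdot>\<^sub>v unit_vec (2 * n) j"
        by (rule eq_vecI)
          (use T1'c T2 T'c j j2 km in \<open>auto simp: diag_block_mat_pair T1' mat_diag_def unit_vec_def\<close>)
      finally show ?thesis .
    qed
    moreover have "?X' *\<^sub>v unit_vec (2 * n) j = col X1' j"
      using X'c X1' j j2 by (intro eq_vecI) auto
    moreover have "A0' \<in> carrier_mat n n" using new(1) unfolding regular_pal_system_def by auto
    ultimately show ?thesis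
      using eigenpair_of_standard_pair[OF new(2) A1'c, of "unit_vec (2 * n) j" "mu j"] j2
      by (metis unit_vec_carrier unit_vec_nonzero)
  qed
  show ?thesis unfolding solves_MUP_QP_def using new eig unfolding T1' by blast
qed

end
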